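(* Let $d\geq 0$, $n_0\geq 1$ and $k\geq 1$ be integers. Every graph $G$ with $\operatorname{mad}(G,n_0)<\frac{3}{2} k$ is $k$-choosable with clustering $c:= \max\{\lceil \frac{n_0-1}{k}\rceil, \,57k-51\}$.
   Context: Graphs are finite and simple. For a graph $G$ and integer $n_0\geq 1$, $\operatorname{mad}(G,n_0)$ is the maximum average degree of a subgraph of $G$ with at least $n_0$ vertices, unless $|V(G)|<n_0$, in which case $\operatorname{mad}(G,n_0):=0$. In a coloured graph the monochromatic subgraph is the spanning subgraph of edges whose endpoints have the same colour; its connected components are monochromatic components. A colouring has clustering $c$ if every monochromatic component has at most $c$ vertices. A $k$-list-assignment $L$ assigns to each vertex $v$ a set $L(v)$ of at least $k$ colours; an $L$-colouring colours each $v$ with a colour from $L(v)$. $G$ is $k$-choosable with clustering $c$ if for every $k$-list-assignment $L$, $G$ has an $L$-colouring with clustering $c$. *)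

theory Defs
  imports Complex_Main
begin

text \<open>A graph is given by its vertex set \<open>V\<close> and its set \<open>E\<close> of edges, each a two-element set.\<close>

definition simple_graph :: "'a set \<Rightarrow> 'a set set \<Rightarrow> bool" where
  "simple_graph V E \<longleftrightarrow> finite V \<and> (\<forall>e\<in>E. e \<subseteq> V \<and> card e = 2)"

definition is_subgraph :: "'a set \<Rightarrow> 'a set set \<Rightarrow> 'a set \<Rightarrow> 'a set set \<Rightarrow> bool" where
  "is_subgraph W F V E \<longleftrightarrow> simple_graph W F \<and> W \<subseteq> V \<and> F \<subseteq> E"

definition degree :: "'a set set \<Rightarrow> 'a \<Rightarrow> nat" where
  "degree E v = card {e \<in> E. v \<in> e}"

definition average_degree :: "'a set \<Rightarrow> 'a set set \<Rightarrow> real" where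
  "average_degree V E = (\<Sum>v\<in>V. real (degree E v)) / real (card V)"

text \<open>For a finite graph the set below is finite, and in the second branch it is nonempty because
  the graph is a subgraph of itself. Only \<open>n0 \<ge> 1\<close> is meaningful, so that the subgraphs have a vertex.\<close>

definition mad :: "'a set \<Rightarrow> 'a set set \<Rightarrow> nat \<Rightarrow> real" where
  "mad V E n0 =
    (if card V < n0 then 0
     else Max {average_degree W F | W F. is_subgraph W F V E \<and> n0 \<le> card W})"

definition connected_components :: "'a set \<Rightarrow> 'a set set \<Rightarrow> 'a set set" where
  "connected_components V E = V // {(u, v). u \<in> V \<and> v \<in> V \<and> (u, v) \<in> {(x, y). {x, y} \<in> E}\<^sup>*}"

definition monochromatic_edges :: "'a set set \<Rightarrow> ('a \<Rightarrow> 'c) \<Rightarrow> 'a set set" where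
  "monochromatic_edges E f = {e \<in> E. \<forall>u\<in>e. \<forall>v\<in>e. f u = f v}"

definition monochromatic_components :: "'a set \<Rightarrow> 'a set set \<Rightarrow> ('a \<Rightarrow> 'c) \<Rightarrow> 'a set set" where
  "monochromatic_components V E f = connected_components V (monochromatic_edges E f)"

definition has_clustering :: "'a set \<Rightarrow> 'a set set \<Rightarrow> ('a \<Rightarrow> 'c) \<Rightarrow> nat \<Rightarrow> bool" where
  "has_clustering V E f c \<longleftrightarrow> (\<forall>C\<in>monochromatic_components V E f. card C \<le> c)"

text \<open>Lists may be infinite; the first disjunct is needed since \<open>card\<close> is 0 on infinite sets.\<close>

definition list_assignment :: "nat \<Rightarrow> 'a set \<Rightarrow> ('a \<Rightarrow> 'c set) \<Rightarrow> bool" where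
  "list_assignment k V L \<longleftrightarrow> (\<forall>v\<in>V. infinite (L v) \<or> k \<le> card (L v))"

definition list_colouring :: "'a set \<Rightarrow> ('a \<Rightarrow> 'c set) \<Rightarrow> ('a \<Rightarrow> 'c) \<Rightarrow> bool" where
  "list_colouring V L f \<longleftrightarrow> (\<forall>v\<in>V. f v \<in> L v)"

text \<open>A definition cannot quantify over the type of colours, so it is passed as an argument;
  a statement with a free type variable \<open>'c\<close> covers all colour types.\<close>

definition choosable_with_clustering ::
    "'c itself \<Rightarrow> 'a set \<Rightarrow> 'a set set \<Rightarrow> nat \<Rightarrow> nat \<Rightarrow> bool" where
  "choosable_with_clustering _ V E k c \<longleftrightarrow>
    (\<forall>L :: 'a \<Rightarrow> 'c set. list_assignment k V L \<longrightarrow>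
      (\<exists>f. list_colouring V L f \<and> has_clustering V E f c))"

end

theory Submission imports Defs begin

text \<open>Let \<open>A\<close> minimise \<open>e(A) - 3 e(V - A) - 3k|A|\<close>, where \<open>e(X)\<close> is the number of edges inside \<open>X\<close>;
  the bound on the average degree makes \<open>A\<close> nonempty. Colour \<open>V - A\<close> inductively and delete from the
  list of each vertex of \<open>A\<close> the colours of its neighbours outside \<open>A\<close>. By minimality of \<open>A\<close> the
  new lists satisfy \<open>2 e(S) + (\<Sum>v\<in>S. deg v) < 3 (\<Sum>v\<in>S. |L v|)\<close> for all nonempty \<open>S \<subseteq> A\<close>.

  Colour \<open>A\<close> with the fewest monochromatic edges. Then monochromatic components are paths and
  cycles, and an interior vertex of a path can move to any other colour that occurs exactly twice
  in its neighbourhood: the number of monochromatic edges stays the same, so the vertex joins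
  ends of paths of the other colour. Cut every long component into segments of \<open>s = 14k - 8\<close>
  vertices and recolour one vertex of each segment, chosen as an independent transversal of a
  conflict graph, so that different recoloured vertices attach to different components. All new
  components then have at most \<open>3s + 1 \<le> 57k - 51\<close> vertices. If there is no such transversal, then
  the conflicts within some set of segments are dominated by few conflict edges (a theorem of
  Haxell), and these segments together with the few path ends that they attach to span too many
  edges for the sparsity condition.\<close>

section \<open>Independent transversals\<close>

definition indep_transversal ::
    "'b set \<Rightarrow> ('b \<Rightarrow> 'i) \<Rightarrow> ('b \<times> 'b) set \<Rightarrow> 'i set \<Rightarrow> ('i \<Rightarrow> 'b) \<Rightarrow> bool" where
  "indep_transversal F p D I g \<longleftrightarrow>
    (\<forall>i\<in>I. g i \<in> F \<and> p (g i) = i) \<and> (\<forall>i\<in>I. \<forall>j\<in>I. (g i, g j) \<notin> D)"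

text \<open>If \<open>D\<close> is minimal, an edge \<open>(x, y)\<close> at the class \<open>i\<close> is the only edge inside some transversal.
  Merging the two classes of \<open>x\<close> and \<open>y\<close> and deleting all neighbours of \<open>x\<close> and \<open>y\<close> leaves no
  transversal, since one would extend by \<open>x\<close> or \<open>y\<close>.\<close>

lemma dominating_edges_of_near_transversal:
  assumes "finite F" "finite I" "i \<in> I" "sym D" "D \<subseteq> F \<times> F" "\<forall>(a, b)\<in>D. p a \<noteq> p b"
    and "indep_transversal F p D (I - {i}) g" "\<nexists>g. indep_transversal F p D I g"
  shows "\<exists>S Z. i \<in> S \<and> S \<subseteq> I \<and> Z \<subseteq> D \<and> card Z < card S \<and> (\<forall>(a, b)\<in>Z. p a \<in> S \<and> p b \<in> S) \<and>
    (\<forall>u\<in>F. p u \<in> S \<longrightarrow> (\<exists>(a, b)\<in>Z. (u, a) \<in> D \<or> (u, b) \<in> D))"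
  using assms
proof (induction "card I" arbitrary: I i F p D g rule: less_induct)
  case less
  note finF = less.prems(1) and finI = less.prems(2) and iI = less.prems(3) and D_sym = less.prems(4)
    and DF = less.prems(5) and cross = less.prems(6) and g = less.prems(7) and noIT = less.prems(8)
  show ?case
  proof (cases "\<exists>w\<in>F. p w = i")
    case False
    \<comment> \<open>An empty class is dominated vacuously, so one class and no edges
      suffice.\<close>
    have "i \<in> {i} \<and> {i} \<subseteq> I \<and> {} \<subseteq> D \<and> card ({}::('b \<times> 'b) set) < card {i}" using iI by simp
    moreover have "\<forall>u\<in>F. p u \<notin> {i}" using False by simp
    ultimately show ?thesis
      by (intro exI[of _ "{i}"] exI[of _ "{}"]) simp
  next
    case True
    then obtain w where w: "w \<in> F" "p w = i" by blast
    \<comment> \<open>\<open>D0\<close> drops the edges at the class \<open>i\<close>, so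
      \<open>g\<close> together with any vertex \<open>w\<close> of that class is independent for
      \<open>D0\<close>. A minimal \<open>D'\<close> between \<open>D0\<close> and \<open>D\<close>
      without a transversal therefore contains an edge at the class \<open>i\<close>.\<close>
    define D0 where "D0 = {(a, b) \<in> D. p a \<noteq> i \<and> p b \<noteq> i}"
    have IT0: "indep_transversal F p D0 I (g(i := w))"
      using g w by (auto simp: indep_transversal_def D0_def)
    define Q where "Q = (\<lambda>D'. D0 \<subseteq> D' \<and> D' \<subseteq> D \<and> sym D' \<and> (\<nexists>g. indep_transversal F p D' I g))"
    have "Q D" using noIT D_sym by (auto simp: Q_def D0_def)
    then obtain D' where D': "Q D'" and D'_min: "\<And>D''. Q D'' \<Longrightarrow> card D' \<le> card D''"
      using ex_has_least_nat[of Q D card] by blast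
    have D'D: "D' \<subseteq> D" and symD': "sym D'" and noIT': "\<nexists>g. indep_transversal F p D' I g"
      and D0D': "D0 \<subseteq> D'" using D' by (auto simp: Q_def)
    have finD': "finite D'" using D'D DF finF by (meson finite_SigmaI finite_subset)
    have "D' \<noteq> D0" using IT0 noIT' by blast
    then obtain a b where ab: "(a, b) \<in> D'" "(a, b) \<notin> D0" using D0D' by auto
    then have "p a = i \<or> p b = i" using D'D by (auto simp: D0_def)
    then obtain x y where xy: "(x, y) \<in> D'" and px: "p x = i"
      using ab symD' by (metis symD)
    have yx: "(y, x) \<in> D'" using xy symD' by (metis symD)
    \<comment> \<open>By minimality, deleting this edge in both directions creates a transversal
      \<open>h\<close>. It is not independent for \<open>D'\<close>, hence contains both
      \<open>x\<close> and \<open>y\<close>.\<close>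
    define D'' where "D'' = D' - {(x, y), (y, x)}"
    have "sym D''" using symD' by (auto simp: D''_def sym_def)
    moreover have "D0 \<subseteq> D''" using D0D' px by (auto simp: D''_def D0_def)
    moreover have "card D'' < card D'"
      unfolding D''_def by (rule psubset_card_mono) (use finD' xy in auto)
    ultimately have "\<not> (\<nexists>g. indep_transversal F p D'' I g)"
      using D'_min[of D''] D'D unfolding Q_def D''_def by (meson Diff_subset leD order_trans)
    then obtain h where h: "indep_transversal F p D'' I h" by blast
    have "\<exists>l\<in>I. \<exists>m\<in>I. (h l, h m) \<in> D'"
      using h noIT' unfolding indep_transversal_def by blast
    then obtain l m where lm: "l \<in> I" "m \<in> I" "(h l, h m) \<in> D'" by blast
    then have "(h l, h m) = (x, y) \<or> (h l, h m) = (y, x)"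
      using h by (auto simp: indep_transversal_def D''_def)
    then have hxy: "h i = x" "h (p y) = y" "p y \<in> I"
      using lm h px by (auto simp: indep_transversal_def)
    define j where "j = p y"
    have ji: "j \<noteq> i" using xy D'D cross px j_def by blast
    \<comment> \<open>\<open>x\<close> and \<open>y\<close> are adjacent, so both disappear from
      \<open>F'\<close>. Away from the classes \<open>i\<close> and \<open>j\<close> the vertices of
      \<open>h\<close> survive, so the merged instance is again a near transversal and the induction
      applies at the class \<open>j\<close>.\<close>
    define F' where "F' = F - {u. (u, x) \<in> D' \<or> (u, y) \<in> D'}"
    define p' where "p' = (\<lambda>u. if p u = i then j else p u)"
    define D1 where "D1 = {(a, b) \<in> D'. a \<in> F' \<and> b \<in> F' \<and> p' a \<noteq> p' b}"
    have h': "indep_transversal F' p' D1 (I - {i} - {j}) h"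
      unfolding indep_transversal_def
    proof (intro conjI ballI)
      fix l assume l: "l \<in> I - {i} - {j}"
      then have hl: "h l \<in> F" "p (h l) = l" "(h l, h i) \<notin> D''" "(h l, h j) \<notin> D''"
        using h iI hxy(3) unfolding indep_transversal_def j_def by blast+
      then have "h l \<noteq> x" "h l \<noteq> y" using l px j_def by auto
      then show "h l \<in> F'" using hl hxy by (auto simp: F'_def D''_def j_def)
      show "p' (h l) = l" using hl l by (simp add: p'_def)
    next
      fix l m assume lm: "l \<in> I - {i} - {j}" "m \<in> I - {i} - {j}"
      then have "p (h l) = l" "p (h m) = m" "(h l, h m) \<notin> D''"
        using h by (auto simp: indep_transversal_def)
      then show "(h l, h m) \<notin> D1" using lm px j_def by (auto simp: D1_def D''_def)
    qed
    have no1: "\<nexists>g. indep_transversal F' p' D1 (I - {i}) g"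
    proof
      assume "\<exists>g. indep_transversal F' p' D1 (I - {i}) g"
      then obtain g1 where g1: "indep_transversal F' p' D1 (I - {i}) g1" by blast
      have jI: "j \<in> I - {i}" using hxy j_def ji by auto
      \<comment> \<open>The merged class is represented by a vertex of one of the old classes
        \<open>i\<close> and \<open>j\<close>. The other class receives \<open>z\<close>, which has
        no neighbour in \<open>F'\<close>.\<close>
      define z where "z = (if p (g1 j) = i then y else x)"
      define g2 where "g2 = (if p (g1 j) = i then g1(i := g1 j, j := y) else g1(i := x))"
      have xyF: "x \<in> F" "y \<in> F" using xy D'D DF by auto
      have pg: "p (g1 j) = i \<or> p (g1 j) = j"
        using g1 jI by (auto simp: indep_transversal_def p'_def split: if_splits)
      have z: "z = x \<or> z = y" by (simp add: z_def)
      have vals: "g2 l = z \<or> (\<exists>l'\<in>I - {i}. g2 l = g1 l')" if "l \<in> I" for l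
        using that jI by (auto simp: g2_def z_def)
      have indep1: "(g1 l, g1 m) \<notin> D'" if "l \<in> I - {i}" "m \<in> I - {i}" for l m
      proof
        assume a: "(g1 l, g1 m) \<in> D'"
        have "l = m"
        proof (rule ccontr)
          assume "l \<noteq> m"
          then show False using a that g1 by (auto simp: indep_transversal_def D1_def)
        qed
        then show False using a D'D cross by blast
      qed
      have indepz: "(g1 l, z) \<notin> D'" "(z, g1 l) \<notin> D'" if "l \<in> I - {i}" for l
      proof -
        have "g1 l \<in> F'" using that g1 by (auto simp: indep_transversal_def)
        then show "(g1 l, z) \<notin> D'" using z by (auto simp: F'_def)
        then show "(z, g1 l) \<notin> D'" using symD' by (metis symD)
      qed
      have "(z, z) \<notin> D'" using D'D cross by blast
      then have ind: "(g2 l, g2 m) \<notin> D'" if "l \<in> I" "m \<in> I" for l m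
        using vals[OF that(1)] vals[OF that(2)] indep1 indepz by metis
      have "g2 l \<in> F \<and> p (g2 l) = l" if "l \<in> I" for l
      proof (cases "l = i \<or> l = j")
        case True
        moreover have "g1 j \<in> F" using g1 jI by (auto simp: indep_transversal_def F'_def)
        ultimately show ?thesis using pg px ji xyF by (auto simp: g2_def j_def)
      next
        case False
        then have "g1 l \<in> F'" "p' (g1 l) = l" "g2 l = g1 l"
          using g1 that by (auto simp: indep_transversal_def g2_def)
        then show ?thesis using False by (auto simp: F'_def p'_def split: if_splits)
      qed
      with ind have "indep_transversal F p D' I g2" by (simp add: indep_transversal_def)
      with noIT' show False by blast
    qed
    have "\<exists>S Z. j \<in> S \<and> S \<subseteq> I - {i} \<and> Z \<subseteq> D1 \<and> card Z < card S \<and> (\<forall>(a, b)\<in>Z. p' a \<in> S \<and> p' b \<in> S) \<and>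
      (\<forall>u\<in>F'. p' u \<in> S \<longrightarrow> (\<exists>(a, b)\<in>Z. (u, a) \<in> D1 \<or> (u, b) \<in> D1))"
    proof (rule less.hyps)
      show "card (I - {i}) < card I" using finI iI by (metis card_Diff1_less)
      show "finite F'" "finite (I - {i})" "j \<in> I - {i}" "D1 \<subseteq> F' \<times> F'" "\<forall>(a, b)\<in>D1. p' a \<noteq> p' b"
        using finF finI hxy j_def ji by (auto simp: F'_def D1_def)
      show "sym D1" using symD' by (auto simp: D1_def sym_def)
    qed (use h' no1 in auto)
    then obtain S Z where SZ: "j \<in> S" "S \<subseteq> I - {i}" "Z \<subseteq> D1" "card Z < card S"
      "\<forall>(a, b)\<in>Z. p' a \<in> S \<and> p' b \<in> S"
      "\<forall>u\<in>F'. p' u \<in> S \<longrightarrow> (\<exists>(a, b)\<in>Z. (u, a) \<in> D1 \<or> (u, b) \<in> D1)" by blast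
    have D1D: "D1 \<subseteq> D" using D'D by (auto simp: D1_def)
    have p'S: "p' a \<in> S \<longleftrightarrow> p a \<in> insert i S" for a
      using SZ(1,2) by (auto simp: p'_def)
    have finS: "finite S" using SZ(2) finI by (meson finite_Diff finite_subset)
    \<comment> \<open>Undoing the merge gains the class \<open>i\<close> at the price of one edge
      \<open>(x, y)\<close>, whose ends dominate everything outside \<open>F'\<close>.\<close>
    have "card (insert (x, y) Z) \<le> Suc (card Z)" by (rule card_insert_le_m1) auto
    also have "\<dots> < card (insert i S)" using SZ(2,4) finS by (subst card_insert_disjoint) auto
    finally have "card (insert (x, y) Z) < card (insert i S)" .
    moreover have "\<forall>(a, b)\<in>insert (x, y) Z. p a \<in> insert i S \<and> p b \<in> insert i S"
      using SZ(1,5) px j_def p'S by auto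
    moreover have "\<exists>(a, b)\<in>insert (x, y) Z. (u, a) \<in> D \<or> (u, b) \<in> D"
      if "u \<in> F" "p u \<in> insert i S" for u
    proof (cases "u \<in> F'")
      case True
      with that SZ(6) p'S obtain a b where "(a, b) \<in> Z" "(u, a) \<in> D1 \<or> (u, b) \<in> D1"
        by blast
      with D1D show ?thesis by blast
    next
      case False
      then show ?thesis using that D'D by (auto simp: F'_def)
    qed
    moreover have "insert (x, y) Z \<subseteq> D" using SZ(3) D1D xy D'D by auto
    moreover have "insert i S \<subseteq> I" using SZ(2) iI by auto
    ultimately show ?thesis
      by (intro exI[of _ "insert i S"] exI[of _ "insert (x, y) Z"]) auto
  qed
qed

text \<open>An index set without a transversal that is smallest in size has a transversal as soon as
  one class is left out. This is the near transversal from which the preceding lemma starts.\<close>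

lemma indep_transversal_or_dominating_edges:
  assumes "finite F" "finite I" "sym D" "D \<subseteq> F \<times> F" "\<forall>(a, b)\<in>D. p a \<noteq> p b"
  obtains g where "indep_transversal F p D I g"
  | S Z where "S \<subseteq> I" "Z \<subseteq> D" "card Z < card S" "\<forall>(a, b)\<in>Z. p a \<in> S \<and> p b \<in> S"
    "\<forall>u\<in>F. p u \<in> S \<longrightarrow> (\<exists>(a, b)\<in>Z. (u, a) \<in> D \<or> (u, b) \<in> D)"
proof (cases "\<exists>g. indep_transversal F p D I g")
  case True
  then show thesis using that(1) by blast
next
  case False
  define Q where "Q = (\<lambda>J. J \<subseteq> I \<and> (\<nexists>g. indep_transversal F p D J g))"
  have "Q I" using False by (simp add: Q_def)
  then obtain J where J: "Q J" and J_min: "\<And>K. Q K \<Longrightarrow> card J \<le> card K"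
    using ex_has_least_nat[of Q I card] by blast
  have JI: "J \<subseteq> I" and noJ: "\<nexists>g. indep_transversal F p D J g" using J by (auto simp: Q_def)
  have finJ: "finite J" using JI assms(2) finite_subset by blast
  have "J \<noteq> {}" using noJ by (auto simp: indep_transversal_def)
  then obtain i where i: "i \<in> J" by blast
  then have "card (J - {i}) < card J" using finJ by (metis card_Diff1_less)
  then have "\<not> Q (J - {i})" using J_min[of "J - {i}"] by linarith
  then obtain g where "indep_transversal F p D (J - {i}) g" using JI by (auto simp: Q_def)
  from dominating_edges_of_near_transversal[OF assms(1) finJ i assms(3-5) this noJ]
  obtain S Z where SZ: "S \<subseteq> J" "Z \<subseteq> D" "card Z < card S" "\<forall>(a, b)\<in>Z. p a \<in> S \<and> p b \<in> S"
    "\<forall>u\<in>F. p u \<in> S \<longrightarrow> (\<exists>(a, b)\<in>Z. (u, a) \<in> D \<or> (u, b) \<in> D)" by blast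
  show thesis by (rule that(2)[OF _ SZ(2-5)]) (use SZ(1) JI in simp)
qed

section \<open>Graphs of maximum degree two\<close>

text \<open>A longest path through \<open>v\<close> cannot be extended at its ends, and an interior
  vertex has used up its two neighbours. So all neighbours stay on the path; the last two
  alternatives allow for the edge that closes a cycle.\<close>

lemma longest_path_closed:
  assumes "finite V" and "symp adj" and "irreflp adj"
    and V: "\<forall>u v. adj u v \<longrightarrow> v \<in> V" and deg: "\<forall>v\<in>V. card {u. adj v u} \<le> 2"
    and "v \<in> V"
  obtains xs where "distinct xs" "set xs \<subseteq> V" "v \<in> set xs"
    "\<And>i. Suc i < length xs \<Longrightarrow> adj (xs ! i) (xs ! Suc i)"
    "\<And>i u. i < length xs \<Longrightarrow> adj (xs ! i) u \<Longrightarrow> \<exists>j<length xs. u = xs ! j \<and>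
      (j = Suc i \<or> i = Suc j \<or> i = 0 \<and> Suc j = length xs \<or> j = 0 \<and> Suc i = length xs)"
proof -
  have sym: "adj v u" if "adj u v" for u v using that assms(2) by (blast dest: sympD)
  have irrefl: "\<not> adj v v" for v using assms(3) by (blast dest: irreflpD)
  define P where "P = (\<lambda>xs. distinct xs \<and> set xs \<subseteq> V \<and> v \<in> set xs \<and>
    (\<forall>i. Suc i < length xs \<longrightarrow> adj (xs ! i) (xs ! Suc i)))"
  have "P [v]" using assms(6) by (simp add: P_def)
  moreover have "length xs < Suc (card V)" if "P xs" for xs
    using that assms(1) card_mono[of V "set xs"] distinct_card[of xs] by (auto simp: P_def)
  ultimately obtain xs where xs: "P xs" and max: "\<And>ys. P ys \<Longrightarrow> length ys \<le> length xs"
    using ex_has_greatest_nat[of P "[v]" length "Suc (card V)"] by (metis less_imp_le)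
  define n where "n = length xs"
  have dist: "distinct xs" and sub: "set xs \<subseteq> V" and step: "\<And>i. Suc i < n \<Longrightarrow> adj (xs ! i) (xs ! Suc i)"
    using xs by (auto simp: P_def n_def)
  have fin: "finite {u. adj w u}" for w
    using V by (intro finite_subset[OF _ assms(1)]) auto
  have inter: "u = xs ! (i - 1) \<or> u = xs ! Suc i" if i: "0 < i" "Suc i < n" and u: "adj (xs ! i) u" for i u
  proof -
    have "{xs ! (i - 1), xs ! Suc i} \<subseteq> {u. adj (xs ! i) u}"
      using step[of i] step[of "i - 1"] i sym by auto
    moreover have "card {xs ! (i - 1), xs ! Suc i} = 2"
      using dist i by (simp add: nth_eq_iff_index_eq n_def)
    moreover have "card {u. adj (xs ! i) u} \<le> 2" using deg sub i n_def by (meson Suc_lessD nth_mem subsetD)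
    ultimately have "{xs ! (i - 1), xs ! Suc i} = {u. adj (xs ! i) u}"
      using card_seteq[OF fin] by metis
    then show ?thesis using u by blast
  qed
  have closed: "\<exists>j<n. u = xs ! j \<and>
      (j = Suc i \<or> i = Suc j \<or> i = 0 \<and> Suc j = n \<or> j = 0 \<and> Suc i = n)"
    if i: "i < n" and u: "adj (xs ! i) u" for i u
  proof (cases "0 < i \<and> Suc i < n")
    case True
    then have "u = xs ! (i - 1) \<or> u = xs ! Suc i" using inter u by blast
    then show ?thesis
    proof
      assume "u = xs ! (i - 1)"
      then show ?thesis using True by (intro exI[of _ "i - 1"]) auto
    qed (use True in auto)
  next
    case ends: False
    have uV: "u \<in> V" using V u by blast
    have "u \<in> set xs"
    proof (rule ccontr)
      assume nin: "u \<notin> set xs"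
      from ends i consider "i = 0" | "Suc i = n" by linarith
      then show False
      proof cases
        case 1
        have "P (u # xs)" unfolding P_def
        proof (intro conjI allI impI)
          fix m assume "Suc m < length (u # xs)"
          then show "adj ((u # xs) ! m) ((u # xs) ! Suc m)"
            using step sym u 1 by (cases m) (auto simp: n_def)
        qed (use xs nin uV in \<open>auto simp: P_def\<close>)
        from max[OF this] show False by simp
      next
        case 2
        have "P (xs @ [u])" unfolding P_def
        proof (intro conjI allI impI)
          fix m assume m: "Suc m < length (xs @ [u])"
          show "adj ((xs @ [u]) ! m) ((xs @ [u]) ! Suc m)"
          proof (cases "Suc m < n")
            case True
            then show ?thesis using step by (simp add: nth_append n_def)
          next
            case False
            then have "m = i" using m 2 by (simp add: n_def)
            then show ?thesis using u 2 by (simp add: nth_append n_def)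
          qed
        qed (use xs nin uV in \<open>auto simp: P_def\<close>)
        from max[OF this] show False by simp
      qed
    qed
    then obtain j where j: "j < n" "u = xs ! j" by (metis in_set_conv_nth n_def)
    have "j \<noteq> i" using irrefl u j by metis
    \<comment> \<open>If \<open>u\<close> is interior, its only neighbours are the two next to it on
      the path; otherwise \<open>xs ! i\<close> and \<open>u\<close> are the two ends.\<close>
    show ?thesis
    proof (cases "0 < j \<and> Suc j < n")
      case True
      then have "xs ! i = xs ! (j - 1) \<or> xs ! i = xs ! Suc j"
        using inter[of j "xs ! i"] u sym j by blast
      then have "i = j - 1 \<or> i = Suc j"
        using dist i j True by (auto simp: nth_eq_iff_index_eq n_def)
      then show ?thesis using j True by (intro exI[of _ j]) auto
    next
      case False
      then show ?thesis using ends j i \<open>j \<noteq> i\<close> by (intro exI[of _ j]) auto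
    qed
  qed
  show thesis
    by (rule that[of xs]) (use xs closed in \<open>auto simp: P_def n_def\<close>)
qed

text \<open>\<open>cp v\<close> enumerates the component of \<open>v\<close> and \<open>ps v\<close>
  is the position of \<open>v\<close> in it. A longest path is closed under adjacency, so it is
  split off as one component and induction treats the rest.\<close>

lemma path_decomposition:
  assumes "finite V" and "symp adj" and "irreflp adj"
    and "\<forall>u v. adj u v \<longrightarrow> v \<in> V" and "\<forall>v\<in>V. card {u. adj v u} \<le> 2"
  shows "\<exists>(cp :: 'a \<Rightarrow> 'a list) ps.
    (\<forall>v\<in>V. ps v < length (cp v) \<and> cp v ! ps v = v) \<and>
    (\<forall>v\<in>V. \<forall>i<length (cp v). cp v ! i \<in> V \<and> cp (cp v ! i) = cp v \<and> ps (cp v ! i) = i) \<and>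
    (\<forall>v\<in>V. \<forall>i. Suc i < length (cp v) \<longrightarrow> adj (cp v ! i) (cp v ! Suc i)) \<and>
    (\<forall>u\<in>V. \<forall>v. adj u v \<longrightarrow> cp v = cp u \<and> (ps v = Suc (ps u) \<or> ps u = Suc (ps v) \<or>
      ps u = 0 \<and> Suc (ps v) = length (cp u) \<or> ps v = 0 \<and> Suc (ps u) = length (cp u)))"
  using assms
proof (induction "card V" arbitrary: V adj rule: less_induct)
  case less
  note fin = less.prems(1) and inV = less.prems(4) and deg = less.prems(5)
  have sym: "adj v u" if "adj u v" for u v using that less.prems(2) by (blast dest: sympD)
  show ?case
  proof (cases "V = {}")
    case False
    then obtain v where v: "v \<in> V" by blast
    obtain xs where xs: "distinct xs" "set xs \<subseteq> V" "v \<in> set xs"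
      "\<And>i. Suc i < length xs \<Longrightarrow> adj (xs ! i) (xs ! Suc i)"
      and closed: "\<And>i u. i < length xs \<Longrightarrow> adj (xs ! i) u \<Longrightarrow> \<exists>j<length xs. u = xs ! j \<and>
      (j = Suc i \<or> i = Suc j \<or> i = 0 \<and> Suc j = length xs \<or> j = 0 \<and> Suc i = length xs)"
      using longest_path_closed[OF less.prems v] by blast
    define U where "U = V - set xs"
    define adj' where "adj' = (\<lambda>a b. adj a b \<and> a \<in> U)"
    have adjU: "b \<in> U" if "adj' a b" for a b
    proof -
      have "a \<notin> set xs" "adj b a" "b \<in> V" using that sym inV by (auto simp: adj'_def U_def)
      then show ?thesis using closed by (metis DiffI U_def in_set_conv_nth nth_mem)
    qed
    have "\<exists>(cp :: 'a \<Rightarrow> 'a list) ps.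
      (\<forall>v\<in>U. ps v < length (cp v) \<and> cp v ! ps v = v) \<and>
      (\<forall>v\<in>U. \<forall>i<length (cp v). cp v ! i \<in> U \<and> cp (cp v ! i) = cp v \<and> ps (cp v ! i) = i) \<and>
      (\<forall>v\<in>U. \<forall>i. Suc i < length (cp v) \<longrightarrow> adj' (cp v ! i) (cp v ! Suc i)) \<and>
      (\<forall>u\<in>U. \<forall>v. adj' u v \<longrightarrow> cp v = cp u \<and> (ps v = Suc (ps u) \<or> ps u = Suc (ps v) \<or>
        ps u = 0 \<and> Suc (ps v) = length (cp u) \<or> ps v = 0 \<and> Suc (ps u) = length (cp u)))"
    proof (rule less.hyps)
      show "card U < card V" unfolding U_def
        using fin v xs(3) by (intro psubset_card_mono) auto
      show "finite U" using fin by (simp add: U_def)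
      show "symp adj'" using sym adjU by (auto simp: adj'_def intro!: sympI)
      show "irreflp adj'" using less.prems(3) by (auto simp: adj'_def irreflp_on_def)
      show "\<forall>a\<in>U. card {u. adj' a u} \<le> 2" using deg by (simp add: adj'_def U_def)
      show "\<forall>a b. adj' a b \<longrightarrow> b \<in> U" using adjU by blast
    qed
    then obtain cp :: "'a \<Rightarrow> 'a list" and ps where
      A: "\<And>v. v \<in> U \<Longrightarrow> ps v < length (cp v) \<and> cp v ! ps v = v"
      and B: "\<And>v i. v \<in> U \<Longrightarrow> i < length (cp v) \<Longrightarrow>
        cp v ! i \<in> U \<and> cp (cp v ! i) = cp v \<and> ps (cp v ! i) = i"
      and C: "\<And>v i. v \<in> U \<Longrightarrow> Suc i < length (cp v) \<Longrightarrow> adj' (cp v ! i) (cp v ! Suc i)"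
      and D: "\<And>u v. u \<in> U \<Longrightarrow> adj' u v \<Longrightarrow> cp v = cp u \<and> (ps v = Suc (ps u) \<or> ps u = Suc (ps v) \<or>
        ps u = 0 \<and> Suc (ps v) = length (cp u) \<or> ps v = 0 \<and> Suc (ps u) = length (cp u))"
      by (elim exE conjE) (rule that, blast+)
    define cp' where "cp' = (\<lambda>u. if u \<in> set xs then xs else cp u)"
    define ps' where "ps' = (\<lambda>u. if u \<in> set xs then (THE i. i < length xs \<and> xs ! i = u) else ps u)"
    have ps_xs: "ps' (xs ! i) = i" if "i < length xs" for i
      using that xs(1) by (auto simp: ps'_def nth_eq_iff_index_eq intro!: the_equality)
    have cp_xs: "cp' (xs ! i) = xs" if "i < length xs" for i
      using that by (simp add: cp'_def)
    have U_eq: "cp' u = cp u" "ps' u = ps u" if "u \<in> U" for u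
      using that by (auto simp: U_def cp'_def ps'_def)
    have split: "u \<in> U \<or> (\<exists>i<length xs. u = xs ! i)" if "u \<in> V" for u
      using that by (auto simp: U_def in_set_conv_nth)
    have UV: "u \<in> V" if "u \<in> U" for u using that by (simp add: U_def)
    have "\<forall>v\<in>V. ps' v < length (cp' v) \<and> cp' v ! ps' v = v"
      using split A U_eq ps_xs cp_xs by metis
    moreover have "\<forall>v\<in>V. \<forall>i<length (cp' v). cp' v ! i \<in> V \<and> cp' (cp' v ! i) = cp' v \<and> ps' (cp' v ! i) = i"
    proof (intro ballI allI impI)
      fix u i assume "u \<in> V" "i < length (cp' u)"
      from split[OF this(1)] this
      show "cp' u ! i \<in> V \<and> cp' (cp' u ! i) = cp' u \<and> ps' (cp' u ! i) = i"
        using B[of u i] U_eq ps_xs cp_xs UV xs(2) nth_mem by (metis subsetD)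
    qed
    moreover have "\<forall>v\<in>V. \<forall>i. Suc i < length (cp' v) \<longrightarrow> adj (cp' v ! i) (cp' v ! Suc i)"
      using split C U_eq cp_xs xs(4) unfolding adj'_def by metis
    moreover have "\<forall>u\<in>V. \<forall>v. adj u v \<longrightarrow> cp' v = cp' u \<and> (ps' v = Suc (ps' u) \<or> ps' u = Suc (ps' v) \<or>
      ps' u = 0 \<and> Suc (ps' v) = length (cp' u) \<or> ps' v = 0 \<and> Suc (ps' u) = length (cp' u))"
    proof (intro ballI allI impI)
      fix a b assume a: "a \<in> V" and ab: "adj a b"
      from split[OF a] show "cp' b = cp' a \<and> (ps' b = Suc (ps' a) \<or> ps' a = Suc (ps' b) \<or>
        ps' a = 0 \<and> Suc (ps' b) = length (cp' a) \<or> ps' b = 0 \<and> Suc (ps' a) = length (cp' a))"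
      proof
        assume "a \<in> U"
        then show ?thesis using D[of a b] ab adjU[of a b] U_eq by (simp add: adj'_def)
      next
        assume "\<exists>i<length xs. a = xs ! i"
        then obtain i where i: "i < length xs" "a = xs ! i" by blast
        from closed[OF i(1), of b] ab i(2) obtain j where j: "j < length xs" "b = xs ! j"
          "j = Suc i \<or> i = Suc j \<or> i = 0 \<and> Suc j = length xs \<or> j = 0 \<and> Suc i = length xs" by blast
        then show ?thesis using i by (simp add: ps_xs cp_xs)
      qed
    qed
    ultimately show ?thesis by blast
  qed auto
qed

section \<open>Colourings with few monochromatic edges\<close>

text \<open>Components are only ever bounded from above, so it suffices to exhibit supersets closed under
  monochromatic edges.\<close>

definition clustered :: "'a set \<Rightarrow> 'a set set \<Rightarrow> ('a \<Rightarrow> 'c) \<Rightarrow> nat \<Rightarrow> bool" where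
  "clustered V E f c \<longleftrightarrow> (\<forall>v\<in>V. \<exists>K. v \<in> K \<and> K \<subseteq> V \<and> card K \<le> c \<and>
    (\<forall>a\<in>K. \<forall>b. {a, b} \<in> E \<and> f a = f b \<longrightarrow> b \<in> K))"

definition nb :: "'a set set \<Rightarrow> 'a \<Rightarrow> 'a set" where
  "nb E v = {u. {u, v} \<in> E}"

definition cnb :: "'a set set \<Rightarrow> ('a \<Rightarrow> 'c) \<Rightarrow> 'c \<Rightarrow> 'a \<Rightarrow> 'a set" where
  "cnb E f c v = {u \<in> nb E v. f u = c}"

lemma nb_sym: "u \<in> nb E v \<longleftrightarrow> v \<in> nb E u"
  by (simp add: nb_def insert_commute)

lemma cnb_subset: "cnb E f c v \<subseteq> nb E v"
  by (auto simp: cnb_def)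

locale finite_simple_graph =
  fixes V :: "'a set" and E :: "'a set set"
  assumes simple: "simple_graph V E"
begin

lemma finite_V: "finite V" using simple by (simp add: simple_graph_def)

lemma finite_E: "finite E"
  using simple finite_V by (auto simp: simple_graph_def intro: finite_subset[of E "Pow V"])

lemma nb_subset: "nb E v \<subseteq> V" using simple by (auto simp: nb_def simple_graph_def)

lemma finite_nb: "finite (nb E v)" using nb_subset finite_V finite_subset by blast

lemma finite_cnb: "finite (cnb E f c v)" using cnb_subset finite_nb finite_subset by metis

lemma notin_nb: "v \<notin> nb E v" using simple by (auto simp: nb_def simple_graph_def)

lemma edge_cases:
  assumes "e \<in> E" "v \<in> e" obtains u where "e = {u, v}" "u \<in> nb E v"
proof -
  have "card e = 2" using assms simple by (auto simp: simple_graph_def)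
  then obtain a b where "e = {a, b}" by (auto simp: card_2_iff)
  then show thesis using assms that by (auto simp: nb_def insert_commute)
qed

lemma card_nb: "card (nb E v) = card {e \<in> E. v \<in> e}"
proof -
  have "{e \<in> E. v \<in> e} = (\<lambda>u. {u, v}) ` nb E v"
  proof (intro subset_antisym subsetI)
    fix e assume "e \<in> {e \<in> E. v \<in> e}"
    then have "e \<in> E" "v \<in> e" by auto
    then obtain u where "e = {u, v}" "u \<in> nb E v" by (rule edge_cases)
    then show "e \<in> (\<lambda>u. {u, v}) ` nb E v" by blast
  qed (auto simp: nb_def)
  moreover have "inj_on (\<lambda>u. {u, v}) (nb E v)" by (auto simp: inj_on_def doubleton_eq_iff)
  ultimately show ?thesis by (simp add: card_image)
qed

lemma card_monochromatic_edges:
  "card (monochromatic_edges E f) =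
    card {e \<in> monochromatic_edges E f. v \<notin> e} + card (cnb E f (f v) v)"
proof -
  have fin: "finite (monochromatic_edges E f)"
    using finite_E by (auto simp: monochromatic_edges_def)
  have "{e \<in> monochromatic_edges E f. v \<in> e} = (\<lambda>u. {u, v}) ` cnb E f (f v) v"
  proof (intro subset_antisym subsetI)
    fix e assume e: "e \<in> {e \<in> monochromatic_edges E f. v \<in> e}"
    then have "e \<in> E" "v \<in> e" by (auto simp: monochromatic_edges_def)
    then obtain u where u: "e = {u, v}" "u \<in> nb E v" by (rule edge_cases)
    then have "f u = f v" using e unfolding monochromatic_edges_def by blast
    with u show "e \<in> (\<lambda>u. {u, v}) ` cnb E f (f v) v" by (simp add: cnb_def)
  qed (auto simp: cnb_def nb_def monochromatic_edges_def)
  moreover have "inj_on (\<lambda>u. {u, v}) (cnb E f (f v) v)"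
    by (auto simp: inj_on_def doubleton_eq_iff)
  ultimately have "card (cnb E f (f v) v) = card {e \<in> monochromatic_edges E f. v \<in> e}"
    by (simp add: card_image)
  moreover have "monochromatic_edges E f =
      {e \<in> monochromatic_edges E f. v \<notin> e} \<union> {e \<in> monochromatic_edges E f. v \<in> e}" by blast
  ultimately show ?thesis
    using fin card_Un_disjoint[of "{e \<in> monochromatic_edges E f. v \<notin> e}"
        "{e \<in> monochromatic_edges E f. v \<in> e}"] by auto
qed

text \<open>Only edges at \<open>v\<close> change. The additive form avoids subtraction of natural
  numbers.\<close>

lemma card_monochromatic_edges_upd:
  "card (monochromatic_edges E (f(v := c))) + card (cnb E f (f v) v) =
    card (monochromatic_edges E f) + card (cnb E f c v)"
proof -
  have "{e \<in> monochromatic_edges E (f(v := c)). v \<notin> e} = {e \<in> monochromatic_edges E f. v \<notin> e}"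
    by (auto simp: monochromatic_edges_def)
  moreover have "cnb E (f(v := c)) c v = cnb E f c v"
    using notin_nb by (auto simp: cnb_def)
  ultimately show ?thesis
    using card_monochromatic_edges[of f v] card_monochromatic_edges[of "f(v := c)" v] by simp
qed

end

locale sparse_list_graph = finite_simple_graph V E
  for V :: "'a set" and E :: "'a set set" +
  fixes L :: "'a \<Rightarrow> 'c set"
  assumes sparse: "\<And>S. S \<subseteq> V \<Longrightarrow> S \<noteq> {} \<Longrightarrow>
    2 * card {e \<in> E. e \<subseteq> S} + (\<Sum>v\<in>S. card (nb E v)) < 3 * (\<Sum>v\<in>S. card (L v))"
begin

lemma card_nb_less: "v \<in> V \<Longrightarrow> card (nb E v) < 3 * card (L v)"
  using sparse[of "{v}"] by simp

text \<open>An infinite list would have \<open>card\<close> 0, but the strict inequality for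
  \<open>{v}\<close> forces a positive value.\<close>

lemma finite_L: "v \<in> V \<Longrightarrow> finite (L v)" and L_nonempty: "v \<in> V \<Longrightarrow> L v \<noteq> {}"
  using card_nb_less[of v] by (auto intro: card_ge_0_finite)

definition optimal :: "('a \<Rightarrow> 'c) \<Rightarrow> bool" where
  "optimal f \<longleftrightarrow> list_colouring V L f \<and>
    (\<forall>g. list_colouring V L g \<longrightarrow>
      card (monochromatic_edges E f) \<le> card (monochromatic_edges E g))"

lemma optimal_exists: obtains f where "optimal f"
proof -
  have "list_colouring V L (\<lambda>v. SOME c. c \<in> L v)"
    using L_nonempty by (simp add: list_colouring_def some_in_eq)
  then show thesis
    using ex_has_least_nat[of "list_colouring V L" _ "\<lambda>f. card (monochromatic_edges E f)"] that
    unfolding optimal_def by blast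
qed

end

locale optimal_colouring = sparse_list_graph V E L
  for V :: "'a set" and E :: "'a set set" and L :: "'a \<Rightarrow> 'c set" +
  fixes f :: "'a \<Rightarrow> 'c"
  assumes opt: "optimal f"
begin

definition md :: "'a \<Rightarrow> nat" where "md v = card (cnb E f (f v) v)"

text \<open>If \<open>md v = 2\<close>, moving \<open>v\<close> to such a colour trades two
  monochromatic edges for two others, so the colouring stays optimal.\<close>

definition alt :: "'a \<Rightarrow> 'c set" where
  "alt v = {c \<in> L v. c \<noteq> f v \<and> card (cnb E f c v) = 2}"

lemma f_in_L: "v \<in> V \<Longrightarrow> f v \<in> L v"
  using opt by (simp add: optimal_def list_colouring_def)

lemma upd_colouring: "c \<in> L v \<Longrightarrow> list_colouring V L (f(v := c))"
  using f_in_L by (simp add: list_colouring_def)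

lemma md_le: "c \<in> L v \<Longrightarrow> md v \<le> card (cnb E f c v)"
  using card_monochromatic_edges_upd[of f v c] opt upd_colouring[of c v]
  by (auto simp: optimal_def md_def)

lemma sum_cnb_le:
  assumes "v \<in> V" shows "(\<Sum>c\<in>L v. card (cnb E f c v)) \<le> card (nb E v)"
proof -
  have "(\<Sum>c\<in>L v. card (cnb E f c v)) = card (\<Union>c\<in>L v. cnb E f c v)"
    using finite_L[OF assms] finite_cnb by (subst card_UN_disjoint) (auto simp: cnb_def)
  also have "\<dots> \<le> card (nb E v)" using finite_nb by (intro card_mono) (auto simp: cnb_def)
  finally show ?thesis .
qed

text \<open>Otherwise optimality makes every list colour occur at least three times around
  \<open>v\<close>, more than the bound on the degree allows.\<close>

lemma md_le_2: assumes "v \<in> V" shows "md v \<le> 2"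
proof (rule ccontr)
  assume "\<not> md v \<le> 2"
  then have "3 \<le> card (cnb E f c v)" if "c \<in> L v" for c using md_le[OF that] by simp
  then have "3 * card (L v) \<le> (\<Sum>c\<in>L v. card (cnb E f c v))"
    using sum_bounded_below[of "L v" 3 "\<lambda>c. card (cnb E f c v)"] by (simp add: mult.commute)
  then show False using sum_cnb_le[OF assms] card_nb_less[OF assms] by simp
qed

lemma finite_alt: "v \<in> V \<Longrightarrow> finite (alt v)" using finite_L by (simp add: alt_def)

text \<open>By optimality every list colour occurs at least twice around \<open>v\<close>. The
  colour \<open>f v\<close> and those in \<open>alt v\<close> occur exactly twice, all others at
  least three times, and the total is at most the degree.\<close>

lemma card_alt_ge:
  assumes "v \<in> V" "md v = 2" shows "3 * card (L v) \<le> card (nb E v) + card (alt v) + 1"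
proof -
  define h where "h = (\<lambda>c. card (cnb E f c v))"
  have fin: "finite (L v)" using finite_L assms by simp
  have sub: "insert (f v) (alt v) \<subseteq> L v" using f_in_L assms by (auto simp: alt_def)
  have fv: "f v \<notin> alt v" by (simp add: alt_def)
  have c1: "card (insert (f v) (alt v)) = Suc (card (alt v))"
    using finite_alt[OF assms(1)] fv by simp
  have c2: "card (L v - insert (f v) (alt v)) + Suc (card (alt v)) = card (L v)"
    using card_Diff_subset[of "insert (f v) (alt v)" "L v"] sub fin c1
      card_mono[OF fin sub] finite_subset[OF sub fin] by simp
  have "3 \<le> h c" if "c \<in> L v - insert (f v) (alt v)" for c
    using that md_le[of c v] assms(2) by (fastforce simp: alt_def h_def)
  then have "3 * card (L v - insert (f v) (alt v)) \<le> (\<Sum>c\<in>L v - insert (f v) (alt v). h c)"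
    using sum_bounded_below[of "L v - insert (f v) (alt v)" 3 h] by (simp add: mult.commute)
  moreover have "(\<Sum>c\<in>insert (f v) (alt v). h c) = 2 * Suc (card (alt v))"
    using finite_alt[OF assms(1)] fv assms(2) by (simp add: h_def alt_def md_def)
  moreover have "(\<Sum>c\<in>L v. h c) =
      (\<Sum>c\<in>L v - insert (f v) (alt v). h c) + (\<Sum>c\<in>insert (f v) (alt v). h c)"
    using sum.subset_diff[OF sub fin] .
  moreover have "(\<Sum>c\<in>L v. h c) \<le> card (nb E v)" using sum_cnb_le[OF assms(1)] by (simp add: h_def)
  ultimately have "3 * card (L v - insert (f v) (alt v)) + 2 * Suc (card (alt v)) \<le> card (nb E v)"
    by linarith
  then show ?thesis using c2 by simp
qed

text \<open>Moving \<open>v\<close> to the colour \<open>c\<close> gives another optimal colouring, in which \<open>x\<close> has one more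
  monochromatic neighbour.\<close>

lemma md_attached:
  assumes "v \<in> V" "md v = 2" "c \<in> alt v" "x \<in> cnb E f c v" shows "md x \<le> 1"
proof -
  have c: "c \<in> L v" "c \<noteq> f v" "card (cnb E f c v) = 2" using assms(3) by (auto simp: alt_def)
  have xV: "x \<in> V" using assms(4) nb_subset by (auto simp: cnb_def)
  have x: "f x = c" "x \<in> nb E v" using assms(4) by (auto simp: cnb_def)
  have vx: "x \<noteq> v" using x c by auto
  define g where "g = f(v := c)"
  have "card (monochromatic_edges E g) = card (monochromatic_edges E f)"
    using card_monochromatic_edges_upd[of f v c] c assms(2) by (simp add: g_def md_def)
  then have "optimal g" using opt upd_colouring[OF c(1)] by (simp add: optimal_def g_def)
  then interpret g: optimal_colouring V E L g by unfold_locales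
  have gx: "g x = c" using x vx by (simp add: g_def)
  have "cnb E g (g x) x = insert v (cnb E f (f x) x)"
    using x vx c by (auto simp: cnb_def g_def nb_def insert_commute)
  moreover have "v \<notin> cnb E f (f x) x" using x c by (simp add: cnb_def)
  ultimately have "g.md x = Suc (md x)"
    using finite_cnb[of f "f x" x] by (simp add: md_def g.md_def)
  then show ?thesis using g.md_le_2[OF xV] by simp
qed

lemma monochromatic_path_decomposition:
  obtains cp :: "'a \<Rightarrow> 'a list" and ps where
    "\<forall>v\<in>V. ps v < length (cp v) \<and> cp v ! ps v = v"
    "\<forall>v\<in>V. \<forall>i<length (cp v). cp v ! i \<in> V \<and> cp (cp v ! i) = cp v \<and> ps (cp v ! i) = i"
    "\<forall>v\<in>V. \<forall>i. Suc i < length (cp v) \<longrightarrow> cp v ! Suc i \<in> cnb E f (f (cp v ! i)) (cp v ! i)"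
    "\<forall>u\<in>V. \<forall>v. v \<in> cnb E f (f u) u \<longrightarrow> cp v = cp u \<and> (ps v = Suc (ps u) \<or> ps u = Suc (ps v) \<or>
      ps u = 0 \<and> Suc (ps v) = length (cp u) \<or> ps v = 0 \<and> Suc (ps u) = length (cp u))"
proof -
  define adj where "adj = (\<lambda>u v. v \<in> cnb E f (f u) u)"
  have adj: "symp adj" "irreflp adj" "\<forall>u v. adj u v \<longrightarrow> v \<in> V" "\<forall>v\<in>V. card {u. adj v u} \<le> 2"
    using notin_nb nb_subset md_le_2
    by (auto simp: adj_def cnb_def nb_def md_def insert_commute irreflp_on_def intro!: sympI)
  show thesis
    using path_decomposition[OF finite_V adj]
    by (elim exE conjE) (rule that; simp add: adj_def)
qed

end

section \<open>Cutting monochromatic paths and cycles\<close>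

locale path_pieces = optimal_colouring V E L f
  for V :: "'a set" and E :: "'a set set" and L :: "'a \<Rightarrow> 'c set" and f :: "'a \<Rightarrow> 'c" +
  fixes cp :: "'a \<Rightarrow> 'a list" and ps :: "'a \<Rightarrow> nat" and s :: nat
  assumes ps: "\<forall>v\<in>V. ps v < length (cp v) \<and> cp v ! ps v = v"
    and cp: "\<forall>v\<in>V. \<forall>i<length (cp v). cp v ! i \<in> V \<and> cp (cp v ! i) = cp v \<and> ps (cp v ! i) = i"
    and step: "\<forall>v\<in>V. \<forall>i. Suc i < length (cp v) \<longrightarrow> cp v ! Suc i \<in> cnb E f (f (cp v ! i)) (cp v ! i)"
    and adjacent: "\<forall>u\<in>V. \<forall>v. v \<in> cnb E f (f u) u \<longrightarrow> cp v = cp u \<and> (ps v = Suc (ps u) \<or> ps u = Suc (ps v) \<or>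
      ps u = 0 \<and> Suc (ps v) = length (cp u) \<or> ps v = 0 \<and> Suc (ps u) = length (cp u))"
    and even_s: "even s" and s_ge_2: "2 \<le> s"
begin

text \<open>In a component of \<open>N\<close> vertices, segment \<open>j\<close> occupies the \<open>s\<close> positions from \<open>start N j\<close> on. There
  is a gap of one vertex between consecutive segments, and the segments are centred, so that about
  half of the remainder lies at each end.\<close>

definition nseg :: "nat \<Rightarrow> nat" where "nseg N = (N - 1) div (s + 1)"

definition shift :: "nat \<Rightarrow> nat" where "shift N = ((N - 1) mod (s + 1)) div 2"

definition start :: "nat \<Rightarrow> nat \<Rightarrow> nat" where "start N j = 1 + shift N + j * (s + 1)"

text \<open>Inverts \<open>start\<close>. Outside the segments it still gives a location: truncated
  subtraction sends everything before the first segment to 0, and a gap gets the number of the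
  segment before it.\<close>

definition seg :: "'a \<Rightarrow> nat" where
  "seg v = (ps v - (1 + shift (length (cp v)))) div (s + 1)"

definition cls :: "'a \<Rightarrow> 'a list \<times> nat" where "cls v = (cp v, seg v)"

definition segment :: "'a list \<times> nat \<Rightarrow> 'a set" where
  "segment i = {v \<in> V. cp v = fst i \<and> start (length (fst i)) (snd i) \<le> ps v \<and>
    ps v < start (length (fst i)) (snd i) + s}"

definition indices :: "('a list \<times> nat) set" where
  "indices = {(xs, j). xs \<in> cp ` V \<and> j < nseg (length xs)}"

lemma cls_segment: assumes "v \<in> segment i" shows "cls v = i"
proof -
  obtain xs j where i: "i = (xs, j)" by fastforce
  define t where "t = ps v - start (length xs) j"
  have "t < s" "ps v - (1 + shift (length xs)) = j * (s + 1) + t"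
    using assms by (auto simp: segment_def i start_def t_def)
  then have "(ps v - (1 + shift (length xs))) div (s + 1) = j"
    by (intro div_nat_eqI) (auto simp: algebra_simps)
  then have "seg v = j" using assms by (simp add: seg_def segment_def i)
  then show ?thesis using assms by (simp add: cls_def segment_def i)
qed

text \<open>With the remainder \<open>r\<close>, \<open>N = 1 + nseg N * (s + 1) + r\<close>. As
  \<open>r \<le> s\<close> and \<open>s\<close> is even, both \<open>r div 2\<close> and
  \<open>r - r div 2\<close> are at most \<open>s div 2\<close>.\<close>

lemma shift_le: "2 * shift N \<le> s"
  "N \<ge> 1 \<Longrightarrow> N \<le> 1 + nseg N * (s + 1) + shift N + s div 2"
  "N \<ge> 1 \<Longrightarrow> 1 + nseg N * (s + 1) + shift N \<le> N"
proof -
  define r where "r = (N - 1) mod (s + 1)"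
  have r: "r \<le> s" using mod_less_divisor[of "s + 1" "N - 1"] unfolding r_def by linarith
  have shift: "shift N = r div 2" by (simp add: shift_def r_def)
  then show "2 * shift N \<le> s" using r by linarith
  assume "N \<ge> 1"
  then have N: "N = 1 + nseg N * (s + 1) + r"
    using div_mult_mod_eq[of "N - 1" "s + 1"] unfolding nseg_def r_def by linarith
  obtain m where m: "s = 2 * m" using even_s by blast
  have "r \<le> r div 2 + m" "r div 2 \<le> r" using r m by presburger+
  then show "N \<le> 1 + nseg N * (s + 1) + shift N + s div 2" "1 + nseg N * (s + 1) + shift N \<le> N"
    using N shift m by simp_all
qed

lemma start_less:
  assumes "j < nseg N" shows "start N j + s < N"
proof -
  have "N \<ge> 1" using assms by (cases N) (auto simp: nseg_def)
  moreover have "Suc j * (s + 1) \<le> nseg N * (s + 1)" using assms by (intro mult_le_mono1) simp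
  ultimately show ?thesis using shift_le(3)[of N] by (simp add: start_def)
qed

lemma length_pos: "v \<in> V \<Longrightarrow> 1 \<le> length (cp v)" using ps by fastforce

lemma pos_inj: "u \<in> V \<Longrightarrow> v \<in> V \<Longrightarrow> cp u = cp v \<Longrightarrow> ps u = ps v \<Longrightarrow> u = v"
  using ps by metis

lemma card_positions:
  assumes "finite A" shows "card {v \<in> V. cp v = xs \<and> ps v \<in> A} \<le> card A"
  by (rule card_inj_on_le[of ps]) (use assms pos_inj in \<open>auto simp: inj_on_def\<close>)

lemma md_interior:
  assumes v: "v \<in> V" and "0 < ps v" "Suc (ps v) < length (cp v)" shows "md v = 2"
proof -
  define i where "i = ps v"
  have vi: "cp v ! i = v" using ps v by (simp add: i_def)
  have a: "cp v ! Suc i \<in> cnb E f (f v) v" using step v vi assms(3) by (metis i_def)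
  have "Suc (i - 1) = i" using assms(2) i_def by simp
  then have "v \<in> cnb E f (f (cp v ! (i - 1))) (cp v ! (i - 1))"
    using step v vi assms(3) by (metis Suc_lessD i_def)
  then have b: "cp v ! (i - 1) \<in> cnb E f (f v) v" by (auto simp: cnb_def nb_def insert_commute)
  have pos: "ps (cp v ! Suc i) = Suc i" "ps (cp v ! (i - 1)) = i - 1"
    using cp v assms(3) by (auto simp: i_def)
  have "cp v ! Suc i \<noteq> cp v ! (i - 1)"
  proof
    assume "cp v ! Suc i = cp v ! (i - 1)"
    then have "ps (cp v ! Suc i) = ps (cp v ! (i - 1))" by simp
    then show False unfolding pos by simp
  qed
  then have "2 = card {cp v ! Suc i, cp v ! (i - 1)}" by simp
  also have "\<dots> \<le> md v" unfolding md_def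
    using a b finite_cnb[of f "f v" v] by (intro card_mono) auto
  finally show ?thesis using md_le_2[OF v] by simp
qed

lemma ps_end: "v \<in> V \<Longrightarrow> md v \<le> 1 \<Longrightarrow> ps v = 0 \<or> Suc (ps v) = length (cp v)"
  using md_interior[of v] bspec[OF ps, of v] by linarith

text \<open>The offsets by one in \<open>nseg\<close> and \<open>start\<close> keep the first and
  the last position out of all segments, so a vertex of a segment has a neighbour on either
  side.\<close>

lemma segment_interior:
  assumes "v \<in> segment i" "i \<in> indices"
  shows "v \<in> V" "0 < ps v" "Suc (ps v) < length (cp v)" "md v = 2"
proof -
  show v: "v \<in> V" "0 < ps v" using assms(1) by (auto simp: segment_def start_def)
  show "Suc (ps v) < length (cp v)"
    using assms start_less[of "snd i" "length (fst i)"] by (auto simp: segment_def indices_def)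
  then show "md v = 2" using v md_interior by blast
qed

text \<open>Only the first and the last position qualify. This later bounds the number of path ends
  to which dominating candidates attach.\<close>

lemma card_ends: "card {x \<in> V. cp x = xs \<and> md x \<le> 1} \<le> 2"
proof -
  have "{x \<in> V. cp x = xs \<and> md x \<le> 1} \<subseteq> {x \<in> V. cp x = xs \<and> ps x \<in> {0, length xs - 1}}"
    using ps_end by fastforce
  then have "card {x \<in> V. cp x = xs \<and> md x \<le> 1} \<le> card {x \<in> V. cp x = xs \<and> ps x \<in> {0, length xs - 1}}"
    using finite_V by (intro card_mono) auto
  also have "\<dots> \<le> card {0, length xs - 1}" by (rule card_positions) simp
  also have "\<dots> \<le> 2" by (simp add: card_insert_if)
  finally show ?thesis .
qed

lemma segment_eq:
  assumes "(xs, j) \<in> indices"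
  shows "segment (xs, j) = (\<lambda>i. xs ! (start (length xs) j + i)) ` {..<s}"
    "inj_on (\<lambda>i. xs ! (start (length xs) j + i)) {..<s}"
proof -
  obtain v where v: "v \<in> V" "xs = cp v" and j: "j < nseg (length xs)"
    using assms by (auto simp: indices_def)
  have less: "start (length xs) j + i < length xs" if "i < s" for i
    using start_less[OF j] that by simp
  have val: "xs ! i \<in> V \<and> cp (xs ! i) = xs \<and> ps (xs ! i) = i" if "i < length xs" for i
    using cp v that by simp
  show "inj_on (\<lambda>i. xs ! (start (length xs) j + i)) {..<s}"
  proof (rule inj_onI)
    fix a b assume "a \<in> {..<s}" "b \<in> {..<s}"
      "xs ! (start (length xs) j + a) = xs ! (start (length xs) j + b)"
    then have "start (length xs) j + a = start (length xs) j + b"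
      using val less by (metis lessThan_iff)
    then show "a = b" by simp
  qed
  show "segment (xs, j) = (\<lambda>i. xs ! (start (length xs) j + i)) ` {..<s}"
  proof (intro subset_antisym subsetI)
    fix u assume u: "u \<in> segment (xs, j)"
    then have "u = xs ! (start (length xs) j + (ps u - start (length xs) j))"
      using ps by (auto simp: segment_def)
    then show "u \<in> (\<lambda>i. xs ! (start (length xs) j + i)) ` {..<s}"
      using u by (intro image_eqI[of _ _ "ps u - start (length xs) j"]) (auto simp: segment_def)
  qed (use val less in \<open>auto simp: segment_def\<close>)
qed

lemma card_segment: "i \<in> indices \<Longrightarrow> card (segment i) = s"
  using segment_eq[of "fst i" "snd i"] by (simp add: card_image)

text \<open>The gap of one vertex keeps consecutive positions from lying in different segments, and
  the closing edge of a cycle joins two positions outside all segments.\<close>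

lemma monochromatic_same_segment:
  assumes u: "u \<in> segment i" "i \<in> indices" and v: "v \<in> segment j" "j \<in> indices"
    and uv: "v \<in> cnb E f (f u) u"
  shows "i = j"
proof -
  have uV: "u \<in> V" using u by (simp add: segment_def)
  have "cp v = cp u \<and> (ps v = Suc (ps u) \<or> ps u = Suc (ps v) \<or>
      ps u = 0 \<and> Suc (ps v) = length (cp u) \<or> ps v = 0 \<and> Suc (ps u) = length (cp u))"
    using adjacent uV uv by blast
  then have cps: "cp v = cp u" "ps v = Suc (ps u) \<or> ps u = Suc (ps v)"
    using segment_interior[OF u] segment_interior[OF v] by auto
  obtain xs a where i: "i = (xs, a)" by fastforce
  obtain b where j: "j = (xs, b)" using cps u v by (cases j) (auto simp: i segment_def)
  have close: "b \<le> a" if "ps y \<le> Suc (ps x)" "x \<in> segment (xs, a)" "y \<in> segment (xs, b)" for x y a b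
  proof (rule ccontr)
    assume "\<not> b \<le> a"
    then have "Suc a * (s + 1) \<le> b * (s + 1)" by (intro mult_le_mono1) simp
    then show False using that by (auto simp: segment_def start_def)
  qed
  show ?thesis using close[where x = u and y = v and a = a and b = b]
      close[where x = v and y = u and a = b and b = a] cps(2) u(1) v(1) i j by auto
qed

end

section \<open>Pieces of the components after recolouring one vertex of every segment\<close>

locale path_cuts = path_pieces V E L f cp ps s
  for V :: "'a set" and E :: "'a set set" and L :: "'a \<Rightarrow> 'c set" and f :: "'a \<Rightarrow> 'c"
    and cp :: "'a \<Rightarrow> 'a list" and ps :: "'a \<Rightarrow> nat" and s :: nat +
  fixes W :: "'a set" and g :: "'a \<Rightarrow> 'c"
  assumes W_segment: "\<And>w. w \<in> W \<Longrightarrow> \<exists>i\<in>indices. w \<in> segment i"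
    and segment_W: "\<And>i. i \<in> indices \<Longrightarrow> \<exists>w\<in>W. w \<in> segment i"
    and g_alt: "\<And>w. w \<in> W \<Longrightarrow> g w \<in> alt w"
    and no_adj: "\<And>w w'. w \<in> W \<Longrightarrow> w' \<in> W \<Longrightarrow> w' \<in> nb E w \<Longrightarrow> g w \<noteq> g w'"
    and no_share: "\<And>w w' x x'. w \<in> W \<Longrightarrow> w' \<in> W \<Longrightarrow> w \<noteq> w' \<Longrightarrow>
      x \<in> cnb E f (g w) w \<Longrightarrow> x' \<in> cnb E f (g w') w' \<Longrightarrow> cp x \<noteq> cp x'"
begin

text \<open>No cut separates \<open>v\<close> from \<open>u\<close> along the enumeration; the
  closing edge of a cycle is ignored here.\<close>

definition same :: "'a \<Rightarrow> 'a \<Rightarrow> bool" where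
  "same u v \<longleftrightarrow> v \<in> V - W \<and> cp v = cp u \<and> (\<forall>w\<in>W. cp w = cp u \<longrightarrow> (ps w < ps u \<longleftrightarrow> ps w < ps v))"

text \<open>In a component without cuts both alternatives hold vacuously, so every vertex is
  outer.\<close>

definition outer :: "'a \<Rightarrow> bool" where
  "outer u \<longleftrightarrow> (\<forall>w\<in>W. cp w = cp u \<longrightarrow> ps u < ps w) \<or> (\<forall>w\<in>W. cp w = cp u \<longrightarrow> ps w < ps u)"

text \<open>Distinguishes paths from cycles: on a cycle every vertex has two monochromatic
  neighbours.\<close>

definition has_end :: "'a list \<Rightarrow> bool" where
  "has_end xs \<longleftrightarrow> (\<exists>x\<in>V. cp x = xs \<and> md x \<le> 1)"

text \<open>On a cycle the first and the last vertex of the enumeration are adjacent, so there the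
  vertices before the first cut and those after the last cut form a single piece.\<close>

definition piece :: "'a \<Rightarrow> 'a set" where
  "piece u = (if has_end (cp u) \<or> \<not> outer u then {v. same u v}
    else {v \<in> V - W. cp v = cp u \<and> outer v})"

lemma W_props: "w \<in> W \<Longrightarrow> w \<in> V \<and> 0 < ps w \<and> Suc (ps w) < length (cp w) \<and> md w = 2"
  using W_segment segment_interior by blast

lemma cut:
  assumes "v \<in> V" "j < nseg (length (cp v))"
  obtains w where "w \<in> W" "cp w = cp v"
    "start (length (cp v)) j \<le> ps w" "ps w < start (length (cp v)) j + s"
proof -
  have "(cp v, j) \<in> indices" using assms by (auto simp: indices_def)
  then obtain w where "w \<in> W" "w \<in> segment (cp v, j)" using segment_W by blast
  then show thesis using that by (auto simp: segment_def)
qed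

lemma same_bound:
  assumes "u \<in> V" and "\<And>v. same u v \<Longrightarrow> lo \<le> ps v \<and> ps v < hi" shows "card {v. same u v} \<le> hi - lo"
proof -
  have "{v. same u v} \<subseteq> {v \<in> V. cp v = cp u \<and> ps v \<in> {lo..<hi}}"
    using assms(2) by (auto simp: same_def)
  then have "card {v. same u v} \<le> card {v \<in> V. cp v = cp u \<and> ps v \<in> {lo..<hi}}"
    using finite_V by (intro card_mono) auto
  also have "\<dots> \<le> card {lo..<hi}" by (rule card_positions) simp
  finally show ?thesis by simp
qed

lemma before_first_cut:
  assumes "u \<in> V" "0 < nseg (length (cp u))" "\<forall>w\<in>W. cp w = cp u \<longrightarrow> ps u < ps w"
  shows "ps u < s + shift (length (cp u))"
proof -
  obtain w where "w \<in> W" "cp w = cp u" "ps w < start (length (cp u)) 0 + s"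
    using cut[OF assms(1,2)] by blast
  then show ?thesis using assms(3) by (fastforce simp: start_def)
qed

lemma after_last_cut:
  assumes "u \<in> V" "0 < nseg (length (cp u))" "\<forall>w\<in>W. cp w = cp u \<longrightarrow> ps w < ps u"
  shows "length (cp u) - (s + s div 2) \<le> ps u"
proof -
  obtain j where j: "nseg (length (cp u)) = Suc j" using assms(2) gr0_conv_Suc by blast
  obtain w where "w \<in> W" "cp w = cp u" "start (length (cp u)) j \<le> ps w"
    using cut[OF assms(1), of j] j by auto
  then have "start (length (cp u)) j < ps u" using assms(3) by fastforce
  moreover have "length (cp u) \<le> 1 + Suc j * (s + 1) + shift (length (cp u)) + s div 2"
    using shift_le(2)[OF length_pos[OF assms(1)]] j by simp
  ultimately show ?thesis by (simp add: start_def)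
qed

lemma length_short:
  assumes "u \<in> V" "nseg (length (cp u)) = 0" shows "length (cp u) \<le> s + s div 2"
proof -
  have "length (cp u) \<le> 1 + shift (length (cp u)) + s div 2"
    using shift_le(2)[OF length_pos[OF assms(1)]] assms(2) by simp
  then show ?thesis using shift_le(1)[of "length (cp u)"] s_ge_2 even_s by (auto elim!: evenE)
qed

text \<open>Between a path end and the nearest cut there is at most half of the remainder and part
  of one segment. The segments are centred for this purpose: two end pieces and a recoloured vertex
  then have at most \<open>3 * s + 1\<close> vertices.\<close>

lemma card_same_end:
  assumes u: "u \<in> V" "ps u = 0 \<or> Suc (ps u) = length (cp u)"
  shows "card {v. same u v} \<le> s + s div 2"
proof (cases "nseg (length (cp u)) = 0")
  case True
  have "card {v. same u v} \<le> length (cp u) - 0"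
    by (rule same_bound[OF u(1)]) (use ps in \<open>fastforce simp: same_def\<close>)
  then show ?thesis using length_short[OF u(1) True] by simp
next
  case False
  have side: "(\<forall>w\<in>W. cp w = cp v \<longrightarrow> ps v < ps w)" if "ps u = 0" "same u v" for v
    using that W_props unfolding same_def by (metis linorder_neqE_nat not_less_zero pos_inj DiffE)
  have side': "(\<forall>w\<in>W. cp w = cp v \<longrightarrow> ps w < ps v)" if "Suc (ps u) = length (cp u)" "same u v" for v
    using that W_props unfolding same_def by (metis Suc_less_SucD)
  show ?thesis
  proof (cases "ps u = 0")
    case True
    have "card {v. same u v} \<le> (s + shift (length (cp u))) - 0"
    proof (rule same_bound[OF u(1)])
      fix v assume v: "same u v"
      then show "0 \<le> ps v \<and> ps v < s + shift (length (cp u))"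
        using before_first_cut[of v] side[OF True v] False by (simp add: same_def)
    qed
    then show ?thesis using shift_le(1)[of "length (cp u)"] by linarith
  next
    case F: False
    have "card {v. same u v} \<le> length (cp u) - (length (cp u) - (s + s div 2))"
    proof (rule same_bound[OF u(1)])
      fix v assume v: "same u v"
      then have "cp v = cp u" "v \<in> V" by (auto simp: same_def)
      then show "length (cp u) - (s + s div 2) \<le> ps v \<and> ps v < length (cp u)"
        using after_last_cut[of v] side'[OF _ v] False F u(2) ps by (metis bspec gr0I)
    qed
    then show ?thesis by linarith
  qed
qed

text \<open>With \<open>j = seg u\<close>, the cut in segment \<open>j\<close> may lie on either
  side of \<open>u\<close>, but the cut in segment \<open>j - 1\<close> comes before
  \<open>u\<close> and the one in segment \<open>j + 1\<close> after it. Away from the ends the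
  resulting bounds \<open>lo\<close> and \<open>hi\<close> differ by exactly
  \<open>3 * s\<close>.\<close>

lemma card_same:
  assumes u: "u \<in> V" shows "card {v. same u v} \<le> 3 * s"
proof -
  define N where "N = length (cp u)"
  define j where "j = seg u"
  define lo where "lo = (if 1 \<le> j then Suc (start N (j - 1)) else 0)"
  define hi where "hi = (if j + 1 < nseg N then start N (j + 1) + s - 1 else N)"
  have N1: "1 \<le> N" using length_pos[OF u] by (simp add: N_def)
  have psN: "ps u < N" using ps u by (simp add: N_def)
  have pos: "ps u - (1 + shift N) = j * (s + 1) + (ps u - (1 + shift N)) mod (s + 1)"
    unfolding j_def seg_def N_def by (rule div_mult_mod_eq[symmetric])
  have m: "(ps u - (1 + shift N)) mod (s + 1) \<le> s"
    using mod_less_divisor[of "s + 1" "ps u - (1 + shift N)"] by linarith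
  have sm: "2 * shift N \<le> s" by (rule shift_le)
  have NN: "N \<le> 1 + nseg N * (s + 1) + shift N + s div 2" using shift_le(2)[OF N1] .
  have jq: "j \<le> nseg N"
  proof (rule ccontr)
    assume "\<not> j \<le> nseg N"
    then have "Suc (nseg N) * (s + 1) \<le> j * (s + 1)" by (intro mult_le_mono1) simp
    then show False using pos psN NN by simp
  qed
  have "ps u \<le> 1 + shift N + (j * (s + 1) + s)" using pos m by linarith
  then have above: "ps u < start N (j + 1)" by (simp add: start_def)
  have below: "start N (j - 1) + s \<le> ps u" if j1: "1 \<le> j"
  proof -
    obtain i where "j = Suc i" using j1 by (cases j) auto
    then show ?thesis using pos by (simp add: start_def)
  qed
  have "card {v. same u v} \<le> hi - lo"
  proof (rule same_bound[OF u])
    fix v assume v: "same u v"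
    then have vV: "v \<in> V" "cp v = cp u" by (auto simp: same_def)
    have "lo \<le> ps v"
    proof (cases "1 \<le> j")
      case True
      then have "j - 1 < nseg N" using jq by simp
      then obtain w where w: "w \<in> W" "cp w = cp u" "start N (j - 1) \<le> ps w" "ps w < start N (j - 1) + s"
        using cut[OF u] unfolding N_def by blast
      then have "ps w < ps u" using below[OF True] by linarith
      then have "ps w < ps v" using v w by (auto simp: same_def)
      then show ?thesis using w True by (simp add: lo_def)
    qed (simp add: lo_def)
    moreover have "ps v < hi"
    proof (cases "j + 1 < nseg N")
      case True
      then obtain w where w: "w \<in> W" "cp w = cp u" "start N (j + 1) \<le> ps w" "ps w < start N (j + 1) + s"
        using cut[OF u] unfolding N_def by blast
      then have "\<not> ps w < ps u" using above by linarith
      then have "\<not> ps w < ps v" "v \<noteq> w" using v w by (auto simp: same_def)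
      then have "ps v < ps w" using pos_inj[of v w] vV w W_props by fastforce
      then show ?thesis using w True by (simp add: hi_def)
    qed (use bspec[OF ps vV(1)] vV(2) in \<open>simp add: hi_def N_def\<close>)
    ultimately show "lo \<le> ps v \<and> ps v < hi" by simp
  qed
  \<comment> \<open>Where one of the two cuts is missing, the end of the list takes its place, and
    there at most \<open>s div 2\<close> vertices of the remainder are added.\<close>
  also have "hi - lo \<le> 3 * s"
  proof -
    have t: "2 * (s div 2) = s" "2 \<le> s" using even_s s_ge_2 by auto
    show ?thesis
    proof (cases j)
      case 0
      show ?thesis
      proof (cases "1 < nseg N")
        case True
        then show ?thesis using 0 sm t by (simp add: hi_def lo_def start_def)
      next
        case False
        then have "nseg N * (s + 1) \<le> s + 1" by (cases "nseg N") auto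
        then show ?thesis using 0 False NN sm t by (simp add: hi_def lo_def)
      qed
    next
      case (Suc i)
      show ?thesis
      proof (cases "j + 1 < nseg N")
        case True
        then show ?thesis using Suc t by (simp add: hi_def lo_def start_def)
      next
        case False
        then have "nseg N * (s + 1) \<le> (i + 2) * (s + 1)" using Suc by (intro mult_le_mono1) simp
        then show ?thesis using Suc False NN sm t by (simp add: hi_def lo_def start_def)
      qed
    qed
  qed
  finally show ?thesis .
qed

text \<open>Both end parts of the enumeration together: at most \<open>s + shift N\<close> vertices
  before the first cut and \<open>s + s div 2\<close> after the last one.\<close>

lemma card_outer:
  assumes u: "u \<in> V" shows "card {v \<in> V - W. cp v = cp u \<and> outer v} \<le> 3 * s"
proof -
  define N where "N = length (cp u)"
  define A where "A = (if nseg N = 0 then {..<N} else {..<s + shift N} \<union> {N - (s + s div 2)..<N})"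
  have "ps v \<in> A" if "v \<in> V - W" "cp v = cp u" "outer v" for v
    using that before_first_cut[of v] after_last_cut[of v] ps unfolding outer_def A_def N_def by auto
  then have "card {v \<in> V - W. cp v = cp u \<and> outer v} \<le> card {v \<in> V. cp v = cp u \<and> ps v \<in> A}"
    using finite_V by (intro card_mono) auto
  also have "\<dots> \<le> card A" by (rule card_positions) (simp add: A_def)
  also have "\<dots> \<le> 3 * s"
  proof (cases "nseg N = 0")
    case True
    then show ?thesis using length_short[OF u] by (simp add: A_def N_def)
  next
    case False
    have "card A \<le> (s + shift N) + (s + s div 2)"
      using card_Un_le[of "{..<s + shift N}" "{N - (s + s div 2)..<N}"] False by (simp add: A_def)
    then show ?thesis using shift_le(1)[of N] by linarith
  qed
  finally show ?thesis .
qed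

lemma card_piece: "u \<in> V \<Longrightarrow> card (piece u) \<le> 3 * s"
  using card_same card_outer by (simp add: piece_def)

lemma card_piece_end: "x \<in> V \<Longrightarrow> md x \<le> 1 \<Longrightarrow> card (piece x) \<le> s + s div 2"
  using card_same_end ps_end by (auto simp: piece_def has_end_def)

lemma piece_subset: "piece u \<subseteq> V - W" and piece_cp: "x \<in> piece u \<Longrightarrow> cp x = cp u"
  by (auto simp: piece_def same_def split: if_splits)

lemma same_outer: "same u v \<Longrightarrow> u \<notin> W \<Longrightarrow> u \<in> V \<Longrightarrow> outer v \<longleftrightarrow> outer u"
  using pos_inj W_props unfolding same_def outer_def by (metis DiffE linorder_neqE_nat order_less_asym)

lemma piece_self: "u \<in> V - W \<Longrightarrow> u \<in> piece u"
  by (auto simp: piece_def same_def)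

lemma piece_eq:
  assumes "u \<in> V - W" "x \<in> piece u" shows "piece x = piece u"
proof -
  have "cp x = cp u" "outer x \<longleftrightarrow> outer u"
    using assms same_outer[of u x] by (auto simp: piece_def same_def split: if_splits)
  then show ?thesis using assms by (auto simp: piece_def same_def split: if_splits)
qed

text \<open>If the first and the last vertex were adjacent without being consecutive, both would
  have two monochromatic neighbours. A vertex with at most one such neighbour is first or last, so
  the component would have no end.\<close>

lemma no_wrap:
  assumes u: "u \<in> V" and v: "v \<in> cnb E f (f u) u" and "has_end (cp u)"
  shows "ps v = Suc (ps u) \<or> ps u = Suc (ps v)"
proof -
  have *: "False" if a: "a \<in> V" "b \<in> cnb E f (f a) a" "has_end (cp a)" "ps a = 0" "Suc (ps b) = length (cp a)"
    "ps b \<noteq> Suc (ps a)" for a b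
  proof -
    have b: "b \<in> V" "cp b = cp a" "a \<in> cnb E f (f b) b"
      using a nb_subset adjacent by (auto simp: cnb_def nb_def insert_commute)
    have "a \<noteq> b" using a notin_nb by (auto simp: cnb_def)
    then have "ps b \<noteq> 0" using a b pos_inj[of a b] by auto
    then have len: "3 \<le> length (cp a)" using a by linarith
    obtain e where e: "e \<in> V" "cp e = cp a" "md e \<le> 1" using a by (auto simp: has_end_def)
    then have "e = a \<or> e = b" using ps_end[of e] pos_inj a b by fastforce
    moreover have "2 \<le> md a"
    proof -
      have "cp a ! Suc 0 \<in> cnb E f (f a) a" using step a len ps by (metis Suc_le_lessD numeral_3_eq_3 le_less_trans lessI less_imp_le_nat)
      moreover have "ps (cp a ! Suc 0) = Suc 0" using cp a len by simp
      then have "cp a ! Suc 0 \<noteq> b" using a by auto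
      ultimately have "card {cp a ! Suc 0, b} \<le> card (cnb E f (f a) a)"
        using a finite_cnb[of f "f a" a] by (intro card_mono) auto
      then show ?thesis using \<open>cp a ! Suc 0 \<noteq> b\<close> by (simp add: md_def)
    qed
    moreover have "2 \<le> md b"
    proof -
      define n where "n = ps b - 1"
      have n: "Suc n = ps b" "Suc n < length (cp b)" "0 < n" using len a b by (auto simp: n_def)
      then have "b \<in> cnb E f (f (cp b ! n)) (cp b ! n)" using step b ps by metis
      then have nb: "cp b ! n \<in> cnb E f (f b) b" by (auto simp: cnb_def nb_def insert_commute)
      have "ps (cp b ! n) = n" using cp b(1) n Suc_lessD by blast
      then have ne: "cp b ! n \<noteq> a" using a n by auto
      have "card {cp b ! n, a} \<le> card (cnb E f (f b) b)"
        using nb b finite_cnb[of f "f b" b] by (intro card_mono) auto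
      then show ?thesis using ne by (simp add: md_def)
    qed
    ultimately show False using e by auto
  qed
  have vV: "v \<in> V" "cp v = cp u" "u \<in> cnb E f (f v) v"
    using u v nb_subset adjacent by (auto simp: cnb_def nb_def insert_commute)
  show ?thesis
  proof (rule ccontr)
    assume no: "\<not> ?thesis"
    then consider "ps u = 0" "Suc (ps v) = length (cp u)" | "ps v = 0" "Suc (ps u) = length (cp u)"
      using adjacent[rule_format, OF u v] by argo
    then show False
      by cases (use *[of u v] *[of v u] u v vV assms(3) no in \<open>simp_all\<close>)
  qed
qed

text \<open>A monochromatic edge that avoids the cuts either joins consecutive positions, with no
  cut between them, or closes a cycle. In the second case both its ends are outer and
  \<open>piece\<close> has merged them.\<close>

lemma piece_closed:
  assumes u: "u \<in> V - W" and a: "a \<in> piece u" and b: "b \<in> cnb E f (f a) a" "b \<notin> W"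
  shows "b \<in> piece u"
proof -
  have aV: "a \<in> V - W" using a piece_subset by blast
  have bV: "b \<in> V - W" using b nb_subset by (auto simp: cnb_def)
  have adj: "cp b = cp a" "ps b = Suc (ps a) \<or> ps a = Suc (ps b) \<or>
      ps a = 0 \<and> Suc (ps b) = length (cp a) \<or> ps b = 0 \<and> Suc (ps a) = length (cp a)"
    using adjacent aV b by blast+
  have near: "b \<in> piece a" if c: "ps b = Suc (ps a) \<or> ps a = Suc (ps b)"
  proof -
    have "ps w < ps a \<longleftrightarrow> ps w < ps b" if w: "w \<in> W" "cp w = cp a" for w
    proof -
      have "ps w \<noteq> ps a" "ps w \<noteq> ps b" using w W_props pos_inj aV bV adj(1) by (metis DiffE)+
      then show ?thesis using c by linarith
    qed
    then have "same a b" using bV adj by (simp add: same_def)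
    moreover have "outer b" if "outer a" using that same_outer[OF \<open>same a b\<close>] aV by blast
    ultimately show ?thesis using bV adj by (simp add: piece_def)
  qed
  have extreme: "outer x" if "x \<in> V" "ps x = 0 \<or> Suc (ps x) = length (cp x)" for x
    using that W_props unfolding outer_def by (metis Suc_less_SucD gr0I less_nat_zero_code)
  have "b \<in> piece a"
  proof (cases "ps b = Suc (ps a) \<or> ps a = Suc (ps b)")
    case False
    then have "\<not> has_end (cp a)" using no_wrap aV b by blast
    moreover have "outer a" "outer b" using extreme[of a] extreme[of b] aV bV adj False by auto
    ultimately show ?thesis using bV adj by (simp add: piece_def)
  qed (rule near)
  then show ?thesis using piece_eq[OF u a] by simp
qed

text \<open>A recoloured \<open>w\<close> gains two neighbours, each in an end piece of at most
  \<open>s + s div 2\<close> vertices. By \<open>no_adj\<close> and \<open>no_share\<close> no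
  second recoloured vertex joins the same component, and a component without recoloured vertices
  lies in a single piece.\<close>

lemma clustered_recolouring:
  "clustered V E (\<lambda>v. if v \<in> W then g v else f v) (3 * s + 1)"
  unfolding clustered_def
proof
  fix v assume v: "v \<in> V"
  define f' where "f' = (\<lambda>v. if v \<in> W then g v else f v)"
  define goal where "goal = (\<lambda>K. K \<subseteq> V \<and> card K \<le> 3 * s + 1 \<and>
    (\<forall>a\<in>K. \<forall>b. {a, b} \<in> E \<and> f' a = f' b \<longrightarrow> b \<in> K))"
  have attach: "x \<in> V - W \<and> md x \<le> 1" if "w \<in> W" "x \<in> cnb E f (g w) w" for w x
  proof -
    have "md x \<le> 1" using md_attached that g_alt W_props by blast
    moreover have "x \<in> V" using that nb_subset by (auto simp: cnb_def)
    ultimately show ?thesis using W_props by fastforce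
  qed
  define K where "K = (\<lambda>w. insert w (\<Union>x\<in>cnb E f (g w) w. piece x))"
  have goalK: "goal (K w)" if w: "w \<in> W" for w
  proof -
    obtain x y where xy: "cnb E f (g w) w = {x, y}"
      using g_alt[OF w] by (auto simp: alt_def card_2_iff)
    then have ex: "x \<in> V - W" "md x \<le> 1" "y \<in> V - W" "md y \<le> 1" using attach[OF w] by auto
    have Kxy: "K w = insert w (piece x \<union> piece y)" by (simp add: K_def xy)
    have "card (K w) \<le> Suc (card (piece x \<union> piece y))" unfolding Kxy by (rule card_insert_le_m1) auto
    also have "\<dots> \<le> Suc (card (piece x) + card (piece y))" using card_Un_le by simp
    also have "\<dots> \<le> 3 * s + 1"
      using card_piece_end[of x] card_piece_end[of y] ex by simp
    finally have "card (K w) \<le> 3 * s + 1" .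
    moreover have "K w \<subseteq> V" using w W_props piece_subset by (auto simp: K_def)
    moreover have "b \<in> K w" if a: "a \<in> K w" and ab: "{a, b} \<in> E" "f' a = f' b" for a b
    proof (cases "a = w")
      case True
      show ?thesis
      proof (cases "b \<in> W")
        case True
        then have "g w \<noteq> g b" using no_adj[of w b] w ab \<open>a = w\<close> by (auto simp: nb_def insert_commute)
        then show ?thesis using ab True \<open>a = w\<close> w by (simp add: f'_def)
      next
        case False
        then have "b \<in> cnb E f (g w) w"
          using ab \<open>a = w\<close> w by (auto simp: f'_def cnb_def nb_def insert_commute)
        moreover from this have "b \<in> piece b" using piece_self attach w by blast
        ultimately show ?thesis by (auto simp: K_def)
      qed
    next
      case False
      then obtain z where z: "z \<in> cnb E f (g w) w" "a \<in> piece z" using a by (auto simp: K_def)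
      have aW: "a \<notin> W" using z piece_subset by blast
      show ?thesis
      proof (cases "b \<in> W")
        case True
        then have "a \<in> cnb E f (g b) b" using ab aW by (auto simp: f'_def cnb_def nb_def)
        \<comment> \<open>\<open>a\<close> and \<open>z\<close> lie in the same old component, to
          which only \<open>w\<close> attaches.\<close>
        then have "b = w" using no_share[of b w a z] True w z piece_cp by blast
        then show ?thesis by (simp add: K_def)
      next
        case False
        then have "b \<in> cnb E f (f a) a" using ab aW by (auto simp: f'_def cnb_def nb_def insert_commute)
        then have "b \<in> piece z" using piece_closed z False attach[OF w] by blast
        then show ?thesis using z by (auto simp: K_def)
      qed
    qed
    ultimately show ?thesis by (auto simp: goal_def)
  qed
  have "\<exists>K. v \<in> K \<and> goal K"
  proof (cases "v \<in> W")
    case True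
    then show ?thesis using goalK[of v] by (intro exI[of _ "K v"]) (simp add: K_def)
  next
    case False
    then have vW: "v \<in> V - W" using v by simp
    show ?thesis
    proof (cases "\<exists>w\<in>W. \<exists>x\<in>cnb E f (g w) w. x \<in> piece v")
      case True
      then obtain w x where w: "w \<in> W" "x \<in> cnb E f (g w) w" "x \<in> piece v" by blast
      then have "v \<in> piece x" using piece_eq[OF vW w(3)] piece_self[OF vW] by simp
      then have "v \<in> K w" using w by (auto simp: K_def)
      then show ?thesis using goalK w by blast
    next
      case no: False
      have "b \<in> piece v" if a: "a \<in> piece v" and ab: "{a, b} \<in> E" "f' a = f' b" for a b
      proof (cases "b \<in> W")
        case True
        have "a \<notin> W" using a piece_subset by blast
        then have "a \<in> cnb E f (g b) b" using ab True by (auto simp: f'_def cnb_def nb_def)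
        then show ?thesis using no True a by blast
      next
        case False
        have "a \<notin> W" using a piece_subset by blast
        then have "b \<in> cnb E f (f a) a" using ab False by (auto simp: f'_def cnb_def nb_def insert_commute)
        then show ?thesis using piece_closed[OF vW a] False by blast
      qed
      moreover have "piece v \<subseteq> V" using piece_subset by blast
      ultimately have "goal (piece v)" using card_piece[OF v] by (auto simp: goal_def)
      then show ?thesis using piece_self[OF vW] by blast
    qed
  qed
  then show "\<exists>K. v \<in> K \<and> K \<subseteq> V \<and> card K \<le> 3 * s + 1 \<and>
    (\<forall>a\<in>K. \<forall>b. {a, b} \<in> E \<and> (if a \<in> W then g a else f a) = (if b \<in> W then g b else f b) \<longrightarrow> b \<in> K)"
    unfolding goal_def f'_def by blast
qed

end

section \<open>Choosing the recoloured vertices\<close>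

context path_pieces begin

definition candidates :: "('a \<times> 'c) set" where
  "candidates = {(v, c). (\<exists>i\<in>indices. v \<in> segment i) \<and> c \<in> alt v}"

text \<open>The two alternatives are the ways to violate \<open>no_adj\<close> and
  \<open>no_share\<close>. Pairs within one segment are excluded because a transversal picks one
  candidate per segment.\<close>

definition conflicts :: "(('a \<times> 'c) \<times> ('a \<times> 'c)) set" where
  "conflicts = {((v, c), (u, d)). (v, c) \<in> candidates \<and> (u, d) \<in> candidates \<and> cls v \<noteq> cls u \<and>
    (c = d \<and> u \<in> nb E v \<or> (\<exists>x\<in>cnb E f c v. \<exists>y\<in>cnb E f d u. cp x = cp y))}"

lemma candidates_V: "(v, c) \<in> candidates \<Longrightarrow> v \<in> V \<and> md v = 2 \<and> c \<in> alt v"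
  using segment_interior by (auto simp: candidates_def)

lemma finite_candidates: "finite candidates"
  by (rule finite_subset[of _ "Sigma V alt"]) (use candidates_V finite_V finite_alt in auto)

lemma finite_indices: "finite indices"
  by (rule finite_subset[of _ "Sigma (cp ` V) (\<lambda>xs. {..<nseg (length xs)})"])
    (use finite_V in \<open>auto simp: indices_def\<close>)

lemma finite_segment: "finite (segment i)"
  using finite_V by (simp add: segment_def)

lemma segment_disjoint: "i \<noteq> j \<Longrightarrow> segment i \<inter> segment j = {}"
  using cls_segment by blast

lemma card_edges_segment:
  assumes "i \<in> indices" shows "s - 1 \<le> card {e \<in> E. e \<subseteq> segment i}"
proof -
  obtain xs j where i: "i = (xs, j)" by fastforce
  then have xj: "(xs, j) \<in> indices" using assms by simp
  then obtain v where v: "v \<in> V" "xs = cp v" and j: "j < nseg (length xs)"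
    by (auto simp: indices_def)
  define a where "a = (\<lambda>t. xs ! (start (length xs) j + t))"
  have seg: "segment i = a ` {..<s}" and inj: "inj_on a {..<s}"
    using segment_eq[OF xj] by (auto simp: a_def i)
  define h where "h = (\<lambda>t. {a t, a (Suc t)})"
  have "inj_on h {..<s - 1}"
  proof (rule inj_onI)
    fix t u assume tu: "t \<in> {..<s - 1}" "u \<in> {..<s - 1}" "h t = h u"
    then have less: "t < s" "Suc t < s" "u < s" "Suc u < s" by auto
    have eq: "a m = a n \<longleftrightarrow> m = n" if "m < s" "n < s" for m n
      using inj that by (auto simp: inj_on_def)
    from tu(3) have "a t = a u \<and> a (Suc t) = a (Suc u) \<or> a t = a (Suc u) \<and> a (Suc t) = a u"
      by (simp add: h_def doubleton_eq_iff)
    then have "t = u \<or> t = Suc u \<and> Suc t = u" using less by (simp add: eq)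
    then show "t = u" by linarith
  qed
  moreover have "h ` {..<s - 1} \<subseteq> {e \<in> E. e \<subseteq> segment i}"
  proof
    fix e assume "e \<in> h ` {..<s - 1}"
    then obtain t where t: "t < s - 1" "e = h t" by auto
    have "Suc (start (length xs) j + t) < length (cp v)" using start_less[OF j] t(1) v(2) by simp
    then have "a (Suc t) \<in> nb E (a t)"
      using step v cnb_subset unfolding a_def by (metis add_Suc_right subsetD)
    then have "h t \<in> E" by (simp add: nb_def h_def insert_commute)
    then show "e \<in> {e \<in> E. e \<subseteq> segment i}" using t seg by (auto simp: h_def)
  qed
  ultimately show ?thesis
    using card_inj_on_le[of h "{..<s - 1}" "{e \<in> E. e \<subseteq> segment i}"] finite_E by simp
qed

lemma card_edges_segments:
  assumes "S \<subseteq> indices"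
  shows "card S * (s - 1) \<le> card {e \<in> E. e \<subseteq> (\<Union>i\<in>S. segment i)}"
proof -
  have fS: "finite S" using assms finite_indices finite_subset by blast
  have "card S * (s - 1) \<le> (\<Sum>i\<in>S. card {e \<in> E. e \<subseteq> segment i})"
    using assms card_edges_segment
      sum_bounded_below[of S "s - 1" "\<lambda>i. card {e \<in> E. e \<subseteq> segment i}"] by auto
  also have "\<dots> = card (\<Union>i\<in>S. {e \<in> E. e \<subseteq> segment i})"
  proof (rule card_UN_disjoint[symmetric])
    show "\<forall>i\<in>S. \<forall>j\<in>S. i \<noteq> j \<longrightarrow> {e \<in> E. e \<subseteq> segment i} \<inter> {e \<in> E. e \<subseteq> segment j} = {}"
    proof (intro ballI impI equals0I)
      fix i j e assume "i \<noteq> j" "e \<in> {e \<in> E. e \<subseteq> segment i} \<inter> {e \<in> E. e \<subseteq> segment j}"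
      then have "e \<in> E" "e = {}" using segment_disjoint[of i j] by auto
      then show False using simple by (auto simp: simple_graph_def)
    qed
  qed (use fS finite_E in auto)
  also have "\<dots> \<le> card {e \<in> E. e \<subseteq> (\<Union>i\<in>S. segment i)}"
    using finite_E by (intro card_mono) auto
  finally show ?thesis .
qed

text \<open>The degree is at most \<open>3 * k - 1\<close>, and four neighbours are removed: two of
  colour \<open>c\<close> and two of colour \<open>f z\<close>.\<close>

lemma card_blocking_neighbours:
  assumes z: "(z, c) \<in> candidates" and k: "card (L z) \<le> k"
  shows "card (nb E z - cnb E f c z - cnb E f (f z) z) \<le> 3 * k - 5"
proof -
  have zV: "z \<in> V" and md: "card (cnb E f (f z) z) = 2" and c: "card (cnb E f c z) = 2" "c \<noteq> f z"
    using candidates_V[OF z] by (auto simp: md_def alt_def)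
  have "cnb E f c z \<inter> cnb E f (f z) z = {}" using c by (auto simp: cnb_def)
  then have "card (cnb E f c z \<union> cnb E f (f z) z) = 4"
    using c md finite_cnb[of f] by (subst card_Un_disjoint) auto
  moreover have "card (nb E z - (cnb E f c z \<union> cnb E f (f z) z)) =
      card (nb E z) - card (cnb E f c z \<union> cnb E f (f z) z)"
    by (rule card_Diff_subset) (use finite_cnb[of f] in \<open>auto simp: cnb_def\<close>)
  moreover have "card (nb E z) < 3 * k" using card_nb_less[OF zV] k by linarith
  ultimately show ?thesis by (simp add: Diff_eq Int_assoc)
qed

text \<open>\<open>P\<close> is the union of the dominated segments, \<open>X\<close> the set of ends of the components to which the
  dominating candidates attach. A dominated candidate attaches to \<open>X\<close> (then it contributes an edge
  between \<open>P\<close> and \<open>X\<close>) or is one of at most \<open>3k - 5\<close> neighbours of a dominating candidate. The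
  contradiction comes from the sparsity condition for \<open>P\<close> and for \<open>P \<union> X\<close>.\<close>

lemma no_dominating_conflicts:
  assumes k: "\<And>v. v \<in> V \<Longrightarrow> card (L v) \<le> k" and k2: "2 \<le> k" and s: "14 * k \<le> s + 8"
    and S: "S \<subseteq> indices" and Z: "Z \<subseteq> conflicts" "card Z < card S"
    and dom: "\<And>v c. (v, c) \<in> candidates \<Longrightarrow> cls v \<in> S \<Longrightarrow>
      \<exists>(a, b)\<in>Z. ((v, c), a) \<in> conflicts \<or> ((v, c), b) \<in> conflicts"
  shows False
proof -
  define P where "P = (\<Union>i\<in>S. segment i)"
  define VZ where "VZ = fst ` Z \<union> snd ` Z"
  define X where "X = {x \<in> V. md x \<le> 1 \<and> (\<exists>(z, c)\<in>VZ. \<exists>x'\<in>cnb E f c z. cp x' = cp x)}"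
  define FS where "FS = Sigma P alt"
  define F1 where "F1 = {(v, c) \<in> FS. X \<inter> cnb E f c v \<noteq> {}}"
  define EP where "EP = {e \<in> E. e \<subseteq> P}"
  define EPX where "EPX = {e \<in> E. \<exists>v\<in>P. \<exists>x\<in>X. e = {v, x}}"
  have fS: "finite S" using S finite_indices finite_subset by blast
  have "finite (conflicts)"
    by (rule finite_subset[of _ "candidates \<times> candidates"])
      (use finite_candidates in \<open>auto simp: conflicts_def\<close>)
  then have fZ: "finite Z" using Z finite_subset by blast
  have VZ: "VZ \<subseteq> candidates" using Z by (auto simp: VZ_def conflicts_def)
  have fVZ: "finite VZ" using fZ by (simp add: VZ_def)
  have cVZ: "card VZ \<le> 2 * card Z"
    using card_Un_le[of "fst ` Z" "snd ` Z"] card_image_le[OF fZ, of fst] card_image_le[OF fZ, of snd]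
    by (simp add: VZ_def)
  have PV: "P \<subseteq> V" and PX: "P \<inter> X = {}" and mdP: "\<And>v. v \<in> P \<Longrightarrow> md v = 2"
    using segment_interior S by (fastforce simp: P_def X_def)+
  have fP: "finite P" and fX: "finite X" using PV finite_V finite_subset by (auto simp: X_def)
  have "card P = (\<Sum>i\<in>S. card (segment i))"
    unfolding P_def using fS segment_disjoint finite_segment by (intro card_UN_disjoint) blast+
  also have "\<dots> = (\<Sum>i\<in>S. s)" using S card_segment by (intro sum.cong) auto
  finally have cP: "card P = card S * s" by simp
  have "S \<noteq> {}" using Z(2) by auto
  then have Pne: "P \<noteq> {}" using cP s_ge_2 fS by auto
  have fFS: "finite FS" using fP PV finite_alt by (auto simp: FS_def)
  have cFS: "card FS = (\<Sum>v\<in>P. card (alt v))"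
    unfolding FS_def using fP PV finite_alt by (intro card_SigmaI) auto
  \<comment> \<open>A candidate attaches to two vertices, and the component of each has at most two
    ends.\<close>
  have cX: "card X \<le> 4 * card VZ"
  proof -
    have "X \<subseteq> (\<Union>(z, c)\<in>VZ. \<Union>x'\<in>cnb E f c z. {x \<in> V. cp x = cp x' \<and> md x \<le> 1})"
      by (fastforce simp: X_def)
    then have "card X \<le> card (\<Union>(z, c)\<in>VZ. \<Union>x'\<in>cnb E f c z. {x \<in> V. cp x = cp x' \<and> md x \<le> 1})"
      using fVZ finite_cnb[of f] finite_V by (intro card_mono) auto
    also have "\<dots> \<le> (\<Sum>(z, c)\<in>VZ. card (\<Union>x'\<in>cnb E f c z. {x \<in> V. cp x = cp x' \<and> md x \<le> 1}))"
      using card_UN_le[OF fVZ] by (simp add: case_prod_beta)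
    also have "\<dots> \<le> (\<Sum>(z, c)\<in>VZ. 4)"
    proof (rule sum_mono, clarify)
      fix z c assume "(z, c) \<in> VZ"
      then have two: "card (cnb E f c z) = 2" using VZ candidates_V by (auto simp: alt_def)
      have "card (\<Union>x'\<in>cnb E f c z. {x \<in> V. cp x = cp x' \<and> md x \<le> 1}) \<le>
          (\<Sum>x'\<in>cnb E f c z. card {x \<in> V. cp x = cp x' \<and> md x \<le> 1})"
        using finite_cnb by (rule card_UN_le)
      also have "\<dots> \<le> (\<Sum>x'\<in>cnb E f c z. 2)" using card_ends by (intro sum_mono) auto
      also have "\<dots> = 4" using two by simp
      finally show "card (\<Union>x'\<in>cnb E f c z. {x \<in> V. cp x = cp x' \<and> md x \<le> 1}) \<le> 4" .
    qed
    also have "\<dots> = 4 * card VZ" by (simp add: case_prod_beta)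
    finally show ?thesis .
  qed
  \<comment> \<open>A vertex to which a candidate attaches is a path end, so outside
    \<open>F1\<close> no component is shared with a dominating candidate. The conflict is then an
    adjacency with equal new colours.\<close>
  have cF2: "card (FS - F1) \<le> (3 * k - 5) * card VZ"
  proof -
    define B where "B = (\<lambda>(z, c). (nb E z - cnb E f c z - cnb E f (f z) z) \<times> {c})"
    have "FS - F1 \<subseteq> (\<Union>a\<in>VZ. B a)"
    proof (clarify)
      fix u c assume uc: "(u, c) \<in> FS" "(u, c) \<notin> F1"
      then obtain i where i: "i \<in> S" "u \<in> segment i" by (auto simp: FS_def P_def)
      have cand: "(u, c) \<in> candidates" using uc i S by (auto simp: FS_def candidates_def)
      have "cls u \<in> S" using i cls_segment by auto
      from dom[OF cand this] obtain a b where
        "(a, b) \<in> Z" "((u, c), a) \<in> conflicts \<or> ((u, c), b) \<in> conflicts" by blast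
      then have "\<exists>q\<in>VZ. ((u, c), q) \<in> conflicts" unfolding VZ_def by force
      then obtain z d where zd: "(z, d) \<in> VZ" "((u, c), (z, d)) \<in> conflicts" by auto
      have no: "cp x \<noteq> cp y" if x: "x \<in> cnb E f c u" and y: "y \<in> cnb E f d z" for x y
      proof
        assume eq: "cp x = cp y"
        have "x \<in> V" using x nb_subset by (auto simp: cnb_def)
        moreover have "md x \<le> 1" using md_attached x candidates_V[OF cand] by blast
        ultimately have "x \<in> X" using zd(1) y eq by (auto simp: X_def)
        then show False using uc x by (auto simp: F1_def)
      qed
      have cd: "c = d" "z \<in> nb E u" "cls u \<noteq> cls z"
        using zd(2) no by (auto simp: conflicts_def)
      have "f u \<noteq> c" using candidates_V[OF cand] by (auto simp: alt_def)
      then have "u \<notin> cnb E f c z" by (simp add: cnb_def)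
      \<comment> \<open>A monochromatic edge between \<open>u\<close> and \<open>z\<close> would put
        both into one segment, but conflicts join different segments.\<close>
      moreover have "u \<notin> cnb E f (f z) z"
      proof
        assume uz: "u \<in> cnb E f (f z) z"
        obtain j where j: "j \<in> indices" "z \<in> segment j" using zd(1) VZ by (auto simp: candidates_def)
        have "j = i" using monochromatic_same_segment[OF j(2,1) i(2) _ uz] i(1) S by blast
        then show False using cd(3) i(2) j(2) cls_segment by metis
      qed
      ultimately have "(u, c) \<in> B (z, d)" using cd nb_sym[of u E z] by (simp add: B_def)
      then show "(u, c) \<in> (\<Union>a\<in>VZ. B a)" using zd(1) by blast
    qed
    moreover have finB: "finite (B a)" for a using finite_nb by (simp add: B_def case_prod_beta)
    ultimately have "card (FS - F1) \<le> card (\<Union>a\<in>VZ. B a)"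
      using fVZ by (intro card_mono) auto
    also have "\<dots> \<le> (\<Sum>a\<in>VZ. card (B a))" using fVZ by (rule card_UN_le)
    also have "\<dots> \<le> (\<Sum>a\<in>VZ. 3 * k - 5)"
    proof (rule sum_mono)
      fix a assume a: "a \<in> VZ"
      obtain z c where zc: "a = (z, c)" by fastforce
      then have "(z, c) \<in> candidates" using a VZ by auto
      then show "card (B a) \<le> 3 * k - 5"
        using card_blocking_neighbours[of z c k] k candidates_V
        by (fastforce simp: B_def zc card_cartesian_product)
    qed
    finally show ?thesis by (simp add: mult.commute)
  qed
  \<comment> \<open>A candidate \<open>(v, c)\<close> can be recovered from its edge: the end in
    \<open>P\<close> is \<open>v\<close>, and the end in \<open>X\<close> has colour
    \<open>c\<close>.\<close>
  have F1EPX: "card F1 \<le> card EPX"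
  proof -
    define h where "h = (\<lambda>(v, c). {v, SOME x. x \<in> X \<inter> cnb E f c v})"
    have h: "\<exists>x. h (v, c) = {v, x} \<and> x \<in> X \<and> x \<in> nb E v \<and> f x = c \<and> v \<in> P" if "(v, c) \<in> F1" for v c
    proof -
      have "(SOME x. x \<in> X \<inter> cnb E f c v) \<in> X \<inter> cnb E f c v"
        using that by (intro some_in_eq[THEN iffD2]) (auto simp: F1_def)
      then show ?thesis using that by (auto simp: h_def cnb_def F1_def FS_def)
    qed
    have "inj_on h F1"
    proof (rule inj_onI, clarify)
      fix v c v' c' assume a: "(v, c) \<in> F1" "(v', c') \<in> F1" "h (v, c) = h (v', c')"
      obtain x x' where "h (v, c) = {v, x}" "x \<in> X" "f x = c" "v \<in> P"
        "h (v', c') = {v', x'}" "x' \<in> X" "f x' = c'" "v' \<in> P" using h[OF a(1)] h[OF a(2)] by blast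
      then show "v = v' \<and> c = c'" using a(3) PX by (auto simp: doubleton_eq_iff)
    qed
    moreover have "h ` F1 \<subseteq> EPX"
    proof clarify
      fix v c assume "(v, c) \<in> F1"
      from h[OF this] obtain x where "h (v, c) = {v, x}" "x \<in> X" "x \<in> nb E v" "v \<in> P" by blast
      then show "h (v, c) \<in> EPX" by (auto simp: EPX_def nb_def insert_commute)
    qed
    ultimately show ?thesis using finite_E by (intro card_inj_on_le[of h]) (auto simp: EPX_def)
  qed
  have EPXdeg: "card EPX \<le> (\<Sum>x\<in>X. card (nb E x))"
  proof -
    have "card EPX \<le> card (\<Union>x\<in>X. {e \<in> E. x \<in> e})"
      using fX finite_E by (intro card_mono) (auto simp: EPX_def)
    also have "\<dots> \<le> (\<Sum>x\<in>X. card {e \<in> E. x \<in> e})" using fX by (rule card_UN_le)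
    finally show ?thesis by (simp add: card_nb)
  qed
  have "card EP + card EPX = card (EP \<union> EPX)"
    using finite_E PX by (intro card_Un_disjoint[symmetric]) (auto simp: EP_def EPX_def)
  also have "\<dots> \<le> card {e \<in> E. e \<subseteq> P \<union> X}"
    using finite_E by (intro card_mono) (auto simp: EP_def EPX_def)
  finally have "2 * (card EP + card EPX) + (\<Sum>v\<in>P \<union> X. card (nb E v)) < 3 * (\<Sum>v\<in>P \<union> X. card (L v))"
    using sparse[of "P \<union> X"] PV Pne by (auto simp: X_def)
  then have U: "2 * (card EP + card EPX) + (\<Sum>v\<in>P. card (nb E v)) + (\<Sum>v\<in>X. card (nb E v)) <
      3 * (\<Sum>v\<in>P. card (L v)) + 3 * (\<Sum>v\<in>X. card (L v))"
    using fP fX PX by (simp add: sum.union_disjoint distrib_left)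
  have P: "2 * card EP + (\<Sum>v\<in>P. card (nb E v)) < 3 * (\<Sum>v\<in>P. card (L v))"
    using sparse[OF PV Pne] by (simp add: EP_def)
  have "(\<Sum>v\<in>P. 3 * card (L v)) \<le> (\<Sum>v\<in>P. card (nb E v) + card (alt v) + 1)"
    using card_alt_ge PV mdP by (intro sum_mono) auto
  then have altP: "3 * (\<Sum>v\<in>P. card (L v)) \<le> (\<Sum>v\<in>P. card (nb E v)) + card FS + card P"
    by (simp add: sum_distrib_left[symmetric] sum.distrib sum_Suc cFS)
  have LX: "(\<Sum>v\<in>X. card (L v)) \<le> card X * k"
    using sum_bounded_above[of X "\<lambda>v. card (L v)" k] k by (auto simp: X_def)
  have EPge: "card S * (s - 1) \<le> card EP" unfolding EP_def P_def by (rule card_edges_segments[OF S])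
  have FS12: "card FS = card F1 + card (FS - F1)"
  proof -
    have "F1 \<subseteq> FS" by (auto simp: F1_def)
    then show ?thesis using fFS card_mono[of FS F1] finite_subset[of F1 FS] by (simp add: card_Diff_subset)
  qed
  define \<sigma> m n where "\<sigma> = card S" and "m = card Z" and "n = card P"
  have EPn: "n \<le> card EP + \<sigma>"
  proof -
    have "n = card S * (s - 1) + card S" using s_ge_2 cP by (cases s) (auto simp: n_def)
    then show ?thesis using EPge by (simp add: \<sigma>_def)
  qed
  \<comment> \<open>Sparsity of \<open>P \<union> X\<close> yields \<open>2 * card EP + 2 * card F1
    < card (FS - F1) + n + 3 * (card X * k)\<close>, since the degrees in \<open>X\<close> absorb
    one copy of \<open>card F1\<close>. Adding twice the bound from \<open>P\<close> cancels
    \<open>card F1\<close>, and \<open>n \<le> card EP + \<sigma>\<close> eliminates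
    \<open>card EP\<close>.\<close>
  have key: "n < 2 * \<sigma> + card (FS - F1) + card X * k"
  proof -
    have "card F1 \<le> (\<Sum>v\<in>X. card (nb E v))" using F1EPX EPXdeg by linarith
    moreover have P': "2 * card EP < card F1 + card (FS - F1) + n"
      using P altP FS12 unfolding n_def by linarith
    moreover have "2 * (card EP + card EPX) + (\<Sum>v\<in>X. card (nb E v)) <
        card FS + n + 3 * (\<Sum>v\<in>X. card (L v))"
      using U altP unfolding n_def by linarith
    moreover have "3 * (\<Sum>v\<in>X. card (L v)) \<le> 3 * (card X * k)" using LX by linarith
    moreover have "2 * card F1 \<le> 2 * card EPX" using F1EPX by linarith
    ultimately have "2 * card EP + 2 * card F1 < card (FS - F1) + n + 3 * (card X * k)"
      unfolding FS12 distrib_left by linarith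
    then show ?thesis using P' EPn by linarith
  qed
  \<comment> \<open>A dominating conflict costs \<open>2 * (3 * k - 5)\<close> for blocked
    candidates and \<open>8 * k\<close> for path ends, in total \<open>14 * k - 10\<close>. With the
    2 per segment from \<open>key\<close> this gives the segment length
    \<open>14 * k - 8\<close>.\<close>
  have "card (FS - F1) \<le> (3 * k - 5) * (2 * m)"
    unfolding m_def by (rule order_trans[OF cF2 mult_le_mono2[OF cVZ]])
  moreover have "card X * k \<le> (8 * m) * k"
    using cX cVZ by (intro mult_le_mono1) (simp add: m_def)
  moreover have "(3 * k - 5) * (2 * m) + (8 * m) * k = (14 * k - 10) * m"
    using k2 by (simp add: algebra_simps diff_mult_distrib2)
  moreover have "(14 * k - 10) * m \<le> (14 * k - 10) * \<sigma>"
    using Z(2) by (intro mult_le_mono2) (simp add: m_def \<sigma>_def)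
  moreover have "(14 * k - 10) * \<sigma> + 2 * \<sigma> = (14 * k - 8) * \<sigma>"
    using k2 by (simp add: algebra_simps diff_mult_distrib2)
  moreover have "(14 * k - 8) * \<sigma> \<le> n"
    unfolding n_def cP \<sigma>_def mult.commute[of "card S" s]
    by (rule mult_le_mono1) (use s in linarith)
  ultimately show False using key by linarith
qed

lemma clustered_colouring_exists:
  assumes k: "\<And>v. v \<in> V \<Longrightarrow> card (L v) \<le> k" and k2: "2 \<le> k" and s: "14 * k \<le> s + 8"
  shows "\<exists>f'. list_colouring V L f' \<and> clustered V E f' (3 * s + 1)"
proof -
  have "sym conflicts"
  proof (rule symI)
    fix a b assume ab: "(a, b) \<in> conflicts"
    obtain v c u d where vu: "a = (v, c)" "b = (u, d)" by fastforce
    have "c = d \<and> u \<in> nb E v \<or> (\<exists>x\<in>cnb E f c v. \<exists>y\<in>cnb E f d u. cp x = cp y)"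
      using ab by (simp add: vu conflicts_def)
    then have "d = c \<and> v \<in> nb E u \<or> (\<exists>y\<in>cnb E f d u. \<exists>x\<in>cnb E f c v. cp y = cp x)"
      using nb_sym by metis
    moreover have "cls u \<noteq> cls v" using ab by (auto simp: vu conflicts_def)
    ultimately show "(b, a) \<in> conflicts" using ab by (simp add: vu conflicts_def)
  qed
  moreover have "conflicts \<subseteq> candidates \<times> candidates" by (auto simp: conflicts_def)
  moreover have "\<forall>(a, b)\<in>conflicts. cls (fst a) \<noteq> cls (fst b)" by (auto simp: conflicts_def)
  ultimately obtain h where h: "indep_transversal candidates (\<lambda>a. cls (fst a)) conflicts indices h"
  proof (rule indep_transversal_or_dominating_edges[OF finite_candidates finite_indices])
    fix S Z assume S: "S \<subseteq> indices" and Z: "Z \<subseteq> conflicts" "card Z < card S"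
      and dom: "\<forall>u\<in>candidates. cls (fst u) \<in> S \<longrightarrow>
        (\<exists>(a, b)\<in>Z. (u, a) \<in> conflicts \<or> (u, b) \<in> conflicts)"
    have False by (rule no_dominating_conflicts[OF k k2 s S Z]) (use dom in auto)
    then show thesis ..
  qed
  have hi: "h i \<in> candidates" "cls (fst (h i)) = i" if "i \<in> indices" for i
    using h that by (auto simp: indep_transversal_def)
  have hij: "(h i, h j) \<notin> conflicts" if "i \<in> indices" "j \<in> indices" for i j
    using h that by (auto simp: indep_transversal_def)
  define W where "W = (\<lambda>i. fst (h i)) ` indices"
  \<comment> \<open>The class of a vertex in \<open>W\<close> determines the chosen candidate, from
    which its new colour is read off.\<close>
  define g where "g = (\<lambda>w. snd (h (cls w)))"
  have W: "cls w \<in> indices \<and> h (cls w) = (w, g w) \<and> (w, g w) \<in> candidates" if w: "w \<in> W" for w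
  proof -
    obtain i where i: "i \<in> indices" "w = fst (h i)" using w unfolding W_def by blast
    then have "cls w = i" using hi by simp
    then show ?thesis using i hi(1)[OF i(1)] by (simp add: g_def)
  qed
  have Wseg: "w \<in> segment (cls w)" if "w \<in> W" for w
    using W[OF that] cls_segment by (auto simp: candidates_def)
  have cls_inj: "w = w'" if "w \<in> W" "w' \<in> W" "cls w = cls w'" for w w'
    using W that by (metis fst_conv)
  interpret path_cuts V E L f cp ps s W g
  proof
    fix w w' assume w: "w \<in> W" "w' \<in> W"
    have nc: "((w, g w), (w', g w')) \<notin> conflicts" using hij[of "cls w" "cls w'"] W w by auto
    have cand: "(w, g w) \<in> candidates" "(w', g w') \<in> candidates" using W w by auto
    have ne: "cls w \<noteq> cls w'" if "w \<noteq> w'" using cls_inj w that by blast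
    show "g w \<noteq> g w'" if nb: "w' \<in> nb E w"
    proof
      assume "g w = g w'"
      moreover have "w \<noteq> w'" using nb notin_nb by blast
      ultimately show False using nc cand ne nb by (simp add: conflicts_def)
    qed
    show "cp x \<noteq> cp x'" if "w \<noteq> w'" "x \<in> cnb E f (g w) w" "x' \<in> cnb E f (g w') w'" for x x'
      using nc cand ne that by (auto simp: conflicts_def)
  next
    fix i assume i: "i \<in> indices"
    then have "fst (h i) \<in> W" by (auto simp: W_def)
    then show "\<exists>w\<in>W. w \<in> segment i" using Wseg hi(2)[OF i] by metis
  qed (use W Wseg candidates_V in blast)+
  have "list_colouring V L (\<lambda>v. if v \<in> W then g v else f v)"
    using f_in_L W candidates_V by (auto simp: list_colouring_def alt_def)
  then show ?thesis using clustered_recolouring by blast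
qed

end

lemma clustered_mono: "clustered V E f c \<Longrightarrow> c \<le> c' \<Longrightarrow> clustered V E f c'"
  unfolding clustered_def by (meson order_trans)

lemma subset_of_card:
  assumes "infinite X \<or> n \<le> card X" obtains Y where "Y \<subseteq> X" "card Y = n" "finite Y"
proof (cases "finite X")
  case True
  then show thesis using assms obtain_subset_with_card_n[of n X] that by blast
next
  case False
  then show thesis using infinite_arbitrarily_large[of X n] that by blast
qed

lemma double_count:
  assumes "finite S" "finite F"
  shows "(\<Sum>v\<in>S. card {e \<in> F. v \<in> e}) = (\<Sum>e\<in>F. card (e \<inter> S))"
proof -
  have "e \<inter> S = {v \<in> S. v \<in> e}" for e by auto
  then show ?thesis
    by (simp only: card_eq_sum sum.inter_filter[OF assms(1)] sum.inter_filter[OF assms(2)])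
      (rule sum.swap)
qed

text \<open>For \<open>k \<ge> 2\<close> the segment length \<open>14 * k - 8\<close> gives
  \<open>42 * k - 23 \<le> 57 * k - 51\<close>. For \<open>k = 1\<close> this comparison fails, but
  there the optimal colouring itself has components of at most three vertices.\<close>

lemma (in sparse_list_graph) clustered_list_colouring_exists:
  assumes k: "\<And>v. v \<in> V \<Longrightarrow> card (L v) \<le> k" and k1: "1 \<le> k"
  shows "\<exists>f. list_colouring V L f \<and> clustered V E f (57 * k - 51)"
proof -
  obtain f where "optimal f" by (rule optimal_exists)
  then interpret optimal_colouring V E L f by unfold_locales
  obtain cp ps where cp_ps: "\<forall>v\<in>V. ps v < length (cp v) \<and> cp v ! ps v = v"
    "\<forall>v\<in>V. \<forall>i<length (cp v). cp v ! i \<in> V \<and> cp (cp v ! i) = cp v \<and> ps (cp v ! i) = i"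
    "\<forall>v\<in>V. \<forall>i. Suc i < length (cp v) \<longrightarrow> cp v ! Suc i \<in> cnb E f (f (cp v ! i)) (cp v ! i)"
    "\<forall>u\<in>V. \<forall>v. v \<in> cnb E f (f u) u \<longrightarrow> cp v = cp u \<and> (ps v = Suc (ps u) \<or> ps u = Suc (ps v) \<or>
      ps u = 0 \<and> Suc (ps v) = length (cp u) \<or> ps v = 0 \<and> Suc (ps u) = length (cp u))"
    by (rule monochromatic_path_decomposition)
  show ?thesis
  proof (cases "2 \<le> k")
    case True
    interpret path_pieces V E L f cp ps "14 * k - 8"
      by (unfold_locales, fact cp_ps(1), fact cp_ps(2), fact cp_ps(3), fact cp_ps(4)) (use True in auto)
    have "14 * k \<le> 14 * k - 8 + 8" by linarith
    then obtain f' where "list_colouring V L f'" "clustered V E f' (3 * (14 * k - 8) + 1)"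
      using clustered_colouring_exists[OF k True] by blast
    moreover have "3 * (14 * k - 8) + 1 \<le> 57 * k - 51" using True by simp
    ultimately show ?thesis using clustered_mono by blast
  next
    case False
    then have "k = 1" using k1 by simp
    \<comment> \<open>2 is the least admissible segment length; the facts about positions taken from
      here do not depend on it.\<close>
    interpret path_pieces V E L f cp ps 2
      by (unfold_locales, fact cp_ps(1), fact cp_ps(2), fact cp_ps(3), fact cp_ps(4)) auto
    \<comment> \<open>In a list of at least four vertices the second and the third have degree at
      least 2. With the edge between them the left side of the sparsity condition is at least
      \<open>2 + 4\<close>, while the right side is at most \<open>3 * 2\<close>.\<close>
    have short: "length (cp v) \<le> 3" if v: "v \<in> V" for v
    proof (rule ccontr)
      assume n: "\<not> length (cp v) \<le> 3"
      define a b where "a = cp v ! 1" and "b = cp v ! 2"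
      have a: "a \<in> V" "ps a = 1" "cp a = cp v" and b: "b \<in> V" "ps b = 2" "cp b = cp v"
        using cp_ps(2) v n by (auto simp: a_def b_def)
      have "2 \<le> card (nb E u)" if "u \<in> V" "md u = 2" for u
        using that card_mono[OF finite_nb cnb_subset, of f "f u" u] by (simp add: md_def)
      then have "2 \<le> card (nb E a)" "2 \<le> card (nb E b)"
        using md_interior[of a] md_interior[of b] a b n by auto
      moreover have "a \<noteq> b" using a b by auto
      moreover have "Suc 1 < length (cp v)" using n by linarith
      then have "b \<in> cnb E f (f a) a"
        using cp_ps(3) v unfolding a_def b_def Suc_1[symmetric] by blast
      then have "{a, b} \<in> E" by (simp add: cnb_def nb_def insert_commute)
      then have "card {{a, b}} \<le> card {e \<in> E. e \<subseteq> {a, b}}"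
        using finite_E by (intro card_mono) auto
      ultimately show False
        using sparse[of "{a, b}"] a(1) b(1) k[OF a(1)] k[OF b(1)] \<open>k = 1\<close> by simp
    qed
    have "clustered V E f 6" unfolding clustered_def
    proof
      fix v assume v: "v \<in> V"
      have "card (set (cp v)) \<le> 6" using card_length[of "cp v"] short[OF v] by linarith
      moreover have "v \<in> set (cp v)" "set (cp v) \<subseteq> V"
        using cp_ps(1,2) v by (auto simp: in_set_conv_nth)
      moreover have "b \<in> set (cp v)" if a: "a \<in> set (cp v)" and ab: "{a, b} \<in> E" "f a = f b" for a b
      proof -
        have "a \<in> V" "cp a = cp v" using a cp_ps(2) v by (auto simp: in_set_conv_nth)
        moreover have "b \<in> cnb E f (f a) a" using ab by (auto simp: cnb_def nb_def insert_commute)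
        ultimately have "cp b = cp v" "b \<in> V"
          using cp_ps(4) nb_subset[of a] by (auto simp: cnb_def)
        then show ?thesis using cp_ps(1) by (metis nth_mem)
      qed
      ultimately show "\<exists>K. v \<in> K \<and> K \<subseteq> V \<and> card K \<le> 6 \<and>
          (\<forall>a\<in>K. \<forall>b. {a, b} \<in> E \<and> f a = f b \<longrightarrow> b \<in> K)"
        by (intro exI[of _ "set (cp v)"]) auto
    qed
    then show ?thesis using f_in_L \<open>k = 1\<close> by (intro exI[of _ f]) (simp add: list_colouring_def)
  qed
qed

text \<open>Greedy choice: if \<open>k\<close> colours of the list of \<open>x\<close> were all used
  \<open>t\<close> times, there would already be \<open>k * t\<close> coloured vertices and no room
  for \<open>x\<close>. This treats graphs with fewer than \<open>n0\<close> vertices, where whole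
  colour classes serve as closed sets.\<close>

lemma equitable_list_colouring:
  assumes "finite V" "card V \<le> k * t" "list_assignment k V L"
  shows "\<exists>f. list_colouring V L f \<and> (\<forall>c. card {v \<in> V. f v = c} \<le> t)"
  using assms
proof (induction V rule: finite_induct)
  case empty
  then show ?case by (simp add: list_colouring_def)
next
  case (insert x F)
  then obtain f where f: "list_colouring F L f" "\<And>c. card {v \<in> F. f v = c} \<le> t"
    by (auto simp: list_assignment_def)
  have "infinite (L x) \<or> k \<le> card (L x)" using insert.prems by (simp add: list_assignment_def)
  then obtain Y where Y: "Y \<subseteq> L x" "card Y = k" "finite Y" by (rule subset_of_card)
  have "\<exists>c\<in>Y. card {v \<in> F. f v = c} < t"
  proof (rule ccontr)
    assume "\<not> ?thesis"
    then have "t \<le> card {v \<in> F. f v = c}" if "c \<in> Y" for c using that by (simp add: not_less)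
    then have "k * t \<le> (\<Sum>c\<in>Y. card {v \<in> F. f v = c})"
      using sum_bounded_below[of Y t "\<lambda>c. card {v \<in> F. f v = c}"] Y(2) by simp
    also have "\<dots> = card (\<Union>c\<in>Y. {v \<in> F. f v = c})"
      using Y insert.hyps by (intro card_UN_disjoint[symmetric]) auto
    also have "\<dots> \<le> card F" using insert.hyps by (intro card_mono) auto
    finally show False using insert.prems insert.hyps by simp
  qed
  then obtain c where c: "c \<in> L x" "card {v \<in> F. f v = c} < t" using Y by blast
  have "card {v \<in> insert x F. (f(x := c)) v = c'} \<le> t" for c'
  proof (cases "c' = c")
    case True
    have "{v \<in> insert x F. (f(x := c)) v = c'} = insert x {v \<in> F. f v = c}"
      using insert.hyps True by auto
    then show ?thesis using c insert.hyps by simp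
  next
    case False
    then have "{v \<in> insert x F. (f(x := c)) v = c'} = {v \<in> F. f v = c'}"
      using insert.hyps by auto
    then show ?thesis using f by simp
  qed
  moreover have "list_colouring (insert x F) L (f(x := c))"
    using f c insert.hyps by (auto simp: list_colouring_def)
  ultimately show ?case by blast
qed

section \<open>Edge counts inside and across vertex sets\<close>

definition edges_in :: "'a set set \<Rightarrow> 'a set \<Rightarrow> 'a set set" where
  "edges_in E S = {e \<in> E. e \<subseteq> S}"

context finite_simple_graph begin

lemma edges_in_simple: "A \<subseteq> V \<Longrightarrow> simple_graph A (edges_in E A)"
  using simple finite_V finite_subset by (auto simp: simple_graph_def edges_in_def)

text \<open>In the degree sum an edge inside \<open>S\<close> counts twice, any other edge of
  \<open>A\<close> that meets \<open>S\<close> once, and an edge inside \<open>A - S\<close> not at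
  all.\<close>

lemma sum_degrees_inside:
  assumes "S \<subseteq> A" "A \<subseteq> V"
  shows "(\<Sum>v\<in>S. card (nb (edges_in E A) v)) + card (edges_in E (A - S)) \<le>
    card (edges_in E A) + card (edges_in E S)"
proof -
  define F where "F = edges_in E A"
  have F: "finite F" "\<And>e. e \<in> F \<Longrightarrow> card e = 2 \<and> finite e \<and> e \<in> E \<and> e \<subseteq> A"
    using finite_E simple assms(2) finite_V
    by (auto simp: F_def edges_in_def simple_graph_def intro: finite_subset)
  have fS: "finite S" using assms finite_V by (meson finite_subset)
  interpret A: finite_simple_graph A F
    unfolding F_def by (rule finite_simple_graph.intro) (rule edges_in_simple[OF assms(2)])
  have "(\<Sum>v\<in>S. card (nb F v)) = (\<Sum>e\<in>F. card (e \<inter> S))"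
    using double_count[OF fS F(1)] by (simp add: A.card_nb)
  also have "\<dots> \<le> (\<Sum>e\<in>F. (if e \<inter> S = {} then 0 else 1) + (if e \<subseteq> S then 1 else 0))"
  proof (rule sum_mono)
    fix e assume e: "e \<in> F"
    have "card (e \<inter> S) < 2" if "\<not> e \<subseteq> S"
      using F(2)[OF e] psubset_card_mono[of e "e \<inter> S"] that by auto
    moreover have "card (e \<inter> S) \<le> 2" using F(2)[OF e] card_mono[of e "e \<inter> S"] by simp
    ultimately show "card (e \<inter> S) \<le> (if e \<inter> S = {} then 0 else 1) + (if e \<subseteq> S then 1 else 0)"
      using F(2)[OF e] by (cases "e \<subseteq> S") (auto simp: Int_absorb2)
  qed
  also have "\<dots> = card {e \<in> F. e \<inter> S \<noteq> {}} + card {e \<in> F. e \<subseteq> S}"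
  proof -
    have "(if e \<inter> S = {} then 0 else 1) = (if e \<inter> S \<noteq> {} then 1 else 0 :: nat)" for e by simp
    then show ?thesis by (simp only: sum.distrib card_eq_sum sum.inter_filter[OF F(1)])
  qed
  also have "{e \<in> F. e \<subseteq> S} = edges_in E S" using assms by (auto simp: F_def edges_in_def)
  also have "{e \<in> F. e \<inter> S \<noteq> {}} = F - edges_in E (A - S)" by (auto simp: F_def edges_in_def)
  also have "card (F - edges_in E (A - S)) = card F - card (edges_in E (A - S))"
    using F(1) finite_E by (intro card_Diff_subset) (auto simp: F_def edges_in_def)
  finally have "(\<Sum>v\<in>S. card (nb F v)) \<le> card F - card (edges_in E (A - S)) + card (edges_in E S)" .
  moreover have "card (edges_in E (A - S)) \<le> card F"
    using F(1) by (intro card_mono) (auto simp: F_def edges_in_def)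
  ultimately show ?thesis unfolding F_def by linarith
qed

text \<open>The edges inside \<open>B\<close>, those inside \<open>S\<close> and those between the
  two sets form disjoint families.\<close>

lemma sum_degrees_across:
  assumes "S \<inter> B = {}" "S \<subseteq> V" "B \<subseteq> V"
  shows "card (edges_in E B) + card (edges_in E S) + (\<Sum>v\<in>S. card (nb E v \<inter> B)) \<le>
    card (edges_in E (B \<union> S))"
proof -
  define T where "T = (\<lambda>(v, u). {v, u}) ` (SIGMA v:S. nb E v \<inter> B)"
  have fS: "finite S" using assms finite_V finite_subset by blast
  have fin: "finite (edges_in E W)" for W using finite_E by (simp add: edges_in_def)
  have ne: "e \<noteq> {}" if "e \<in> E" for e using that simple by (auto simp: simple_graph_def)
  have "inj_on (\<lambda>(v, u). {v, u}) (SIGMA v:S. nb E v \<inter> B)"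
    using assms(1) by (auto simp: inj_on_def doubleton_eq_iff)
  then have "card T = (\<Sum>v\<in>S. card (nb E v \<inter> B))"
    unfolding T_def using fS finite_nb by (subst card_image) auto
  moreover have "card (edges_in E B \<union> edges_in E S) = card (edges_in E B) + card (edges_in E S)"
    using fin assms(1) ne by (intro card_Un_disjoint) (fastforce simp: edges_in_def)+
  moreover have "card ((edges_in E B \<union> edges_in E S) \<union> T) = card (edges_in E B \<union> edges_in E S) + card T"
    using fin assms(1) fS finite_nb by (intro card_Un_disjoint) (auto simp: T_def edges_in_def)
  moreover have "card ((edges_in E B \<union> edges_in E S) \<union> T) \<le> card (edges_in E (B \<union> S))"
    using fin by (intro card_mono) (auto simp: T_def edges_in_def nb_def insert_commute)
  ultimately show ?thesis by linarith
qed

end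

section \<open>Reduction to sparse lists\<close>

text \<open>Moving \<open>S\<close> from \<open>A\<close> to the other side must increase
  \<open>\<Phi>\<close>; the two preceding edge counts turn this into the inequality for
  \<open>S\<close>.\<close>

lemma (in finite_simple_graph) sparse_part:
  assumes "4 * card E < 3 * k * card V"
  obtains A where "A \<noteq> {}" "A \<subseteq> V"
    "\<And>S. S \<subseteq> A \<Longrightarrow> S \<noteq> {} \<Longrightarrow> 2 * card (edges_in E S) + (\<Sum>v\<in>S. card (nb (edges_in E A) v)) +
      3 * (\<Sum>v\<in>S. card (nb E v \<inter> (V - A))) < 3 * (k * card S)"
proof -
  define \<Phi> :: "'a set \<Rightarrow> int" where
    "\<Phi> = (\<lambda>A. int (card (edges_in E A)) - 3 * int (card (edges_in E (V - A))) - int (3 * k * card A))"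
  have "finite (\<Phi> ` Pow V)" "\<Phi> ` Pow V \<noteq> {}" using finite_V by auto
  then have "Min (\<Phi> ` Pow V) \<in> \<Phi> ` Pow V" by (rule Min_in)
  then obtain A0 where A0: "A0 \<subseteq> V" "\<Phi> A0 = Min (\<Phi> ` Pow V)" by auto
  have minA0: "\<Phi> A0 \<le> \<Phi> B" if "B \<subseteq> V" for B using A0(2) finite_V that by simp
  \<comment> \<open>Among the minimisers one with fewest vertices is taken, so that every proper
    subset of \<open>A\<close> has a strictly larger value.\<close>
  define Q where "Q = (\<lambda>A. A \<subseteq> V \<and> \<Phi> A = \<Phi> A0)"
  have "Q A0" using A0 by (simp add: Q_def)
  then obtain A where QA: "Q A" and minA: "\<And>B. Q B \<Longrightarrow> card A \<le> card B"
    using ex_has_least_nat[of Q A0 card] by blast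
  have AV: "A \<subseteq> V" using QA by (simp add: Q_def)
  have fA: "finite A" using AV finite_V finite_subset by blast
  have less: "\<Phi> A < \<Phi> B" if "B \<subset> A" for B
  proof -
    have "\<not> Q B" using minA[of B] psubset_card_mono[OF fA that] by auto
    then have "\<Phi> B \<noteq> \<Phi> A" "B \<subseteq> V" using QA AV that by (auto simp: Q_def)
    then show ?thesis using minA0[of B] QA by (auto simp: Q_def)
  qed
  have "edges_in E {} = {}" "edges_in E V = E"
    using simple by (auto simp: edges_in_def simple_graph_def)
  moreover have "int (4 * card E) < int (3 * k * card V)" using assms by (simp only: of_nat_less_iff)
  \<comment> \<open>\<open>\<Phi> {}\<close> is \<open>- 3 * card E\<close> and
    \<open>\<Phi> V\<close> is \<open>card E - 3 * k * card V\<close>, so this is the hypothesis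
    rearranged. The empty set is then no minimiser.\<close>
  ultimately have "\<Phi> V < \<Phi> {}" by (simp add: \<Phi>_def)
  then have "A \<noteq> {}" using minA0[of V] QA by (auto simp: Q_def)
  moreover have "2 * card (edges_in E S) + (\<Sum>v\<in>S. card (nb (edges_in E A) v)) +
      3 * (\<Sum>v\<in>S. card (nb E v \<inter> (V - A))) < 3 * (k * card S)" if S: "S \<subseteq> A" "S \<noteq> {}" for S
  proof -
    define a1 a2 a3 a4 a5 p q where defs: "a1 = card (edges_in E A)" "a2 = card (edges_in E (A - S))"
      "a3 = card (edges_in E (V - A))" "a4 = card (edges_in E (V - A \<union> S))" "a5 = card (edges_in E S)"
      "p = (\<Sum>v\<in>S. card (nb (edges_in E A) v))" "q = (\<Sum>v\<in>S. card (nb E v \<inter> (V - A)))"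
    have "\<Phi> A < \<Phi> (A - S)" by (rule less) (use S in auto)
    moreover have "V - (A - S) = V - A \<union> S" using S AV by auto
    moreover have "card A = card (A - S) + card S"
      using S fA card_Diff_subset[of S A] card_mono[of A S] finite_subset[of S A] by simp
    ultimately have "int a1 - 3 * int a3 - 3 * int (k * card S) < int a2 - 3 * int a4"
      by (simp add: \<Phi>_def defs algebra_simps)
    moreover have "p + a2 \<le> a1 + a5" unfolding defs by (rule sum_degrees_inside[OF S(1) AV])
    moreover have "a3 + a5 + q \<le> a4"
      unfolding defs by (rule sum_degrees_across) (use S AV in auto)
    ultimately have "2 * a5 + p + 3 * q < 3 * (k * card S)" by linarith
    then show ?thesis by (simp add: defs)
  qed
  ultimately show thesis using that AV by blast
qed

lemma clusteredE:
  assumes "clustered V E f c" "v \<in> V"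
  obtains K where "v \<in> K" "K \<subseteq> V" "card K \<le> c"
    "\<And>a b. a \<in> K \<Longrightarrow> {a, b} \<in> E \<Longrightarrow> f a = f b \<Longrightarrow> b \<in> K"
proof -
  from bspec[OF assms(1)[unfolded clustered_def] assms(2)]
  obtain K where K: "v \<in> K \<and> K \<subseteq> V \<and> card K \<le> c \<and>
    (\<forall>a\<in>K. \<forall>b. {a, b} \<in> E \<and> f a = f b \<longrightarrow> b \<in> K)" ..
  show thesis by (rule that[of K]) (use K in blast)+
qed

lemma clustered_cong:
  assumes "\<And>v. v \<in> D \<Longrightarrow> f v = g v" "clustered D (edges_in E D) g c"
  shows "clustered D (edges_in E D) f c"
proof -
  have "f a = g a \<and> f b = g b" if "{a, b} \<in> edges_in E D" for a b
    using assms(1) that by (simp add: edges_in_def)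
  then show ?thesis using assms(2) unfolding clustered_def by metis
qed

lemma clustered_list_colouring_by_extension:
  assumes G: "simple_graph V E" and A: "A \<subseteq> V"
    and fA: "list_colouring A L fA" "clustered A (edges_in E A) fA c"
    and fB: "list_colouring (V - A) L fB" "clustered (V - A) (edges_in E (V - A)) fB c"
    and proper: "\<And>a b. a \<in> A \<Longrightarrow> b \<in> V - A \<Longrightarrow> {a, b} \<in> E \<Longrightarrow> fA a \<noteq> fB b"
  shows "\<exists>f. list_colouring V L f \<and> clustered V E f c"
proof -
  define f where "f = (\<lambda>v. if v \<in> A then fA v else fB v)"
  have EV: "a \<in> V \<and> b \<in> V" if "{a, b} \<in> E" for a b
    using G that by (auto simp: simple_graph_def)
  have same: "a \<in> A \<longleftrightarrow> b \<in> A" if ab: "{a, b} \<in> E" "f a = f b" for a b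
  proof (rule ccontr)
    assume "\<not> ?thesis"
    then consider "a \<in> A" "b \<notin> A" | "a \<notin> A" "b \<in> A" by blast
    then show False
      using proper[of a b] proper[of b a] EV[OF ab(1)] ab by cases (auto simp: f_def insert_commute)
  qed
  have "\<exists>K. v \<in> K \<and> K \<subseteq> V \<and> card K \<le> c \<and> (\<forall>a\<in>K. \<forall>b. {a, b} \<in> E \<and> f a = f b \<longrightarrow> b \<in> K)"
    if v: "v \<in> V" for v
  proof -
    define D where "D = (if v \<in> A then A else V - A)"
    have "v \<in> D" "D \<subseteq> V" using v A by (auto simp: D_def)
    have "clustered A (edges_in E A) f c" "clustered (V - A) (edges_in E (V - A)) f c"
      by (rule clustered_cong[OF _ fA(2)], simp add: f_def, rule clustered_cong[OF _ fB(2)], simp add: f_def)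
    then have "clustered D (edges_in E D) f c" by (simp add: D_def)
    then obtain K where K: "v \<in> K" "K \<subseteq> D" "card K \<le> c"
      "\<And>a b. a \<in> K \<Longrightarrow> {a, b} \<in> edges_in E D \<Longrightarrow> f a = f b \<Longrightarrow> b \<in> K"
      using \<open>v \<in> D\<close> by (rule clusteredE) blast
    have "b \<in> K" if a: "a \<in> K" and ab: "{a, b} \<in> E" "f a = f b" for a b
    proof -
      have "b \<in> D" "a \<in> D" using K(2) a same[OF ab] EV[OF ab(1)] by (auto simp: D_def split: if_splits)
      then show ?thesis using K(4)[OF a] ab by (simp add: edges_in_def)
    qed
    then show ?thesis using K(1-3) \<open>D \<subseteq> V\<close> by (intro exI[of _ K]) auto
  qed
  then have "clustered V E f c" by (simp add: clustered_def)
  moreover have "list_colouring V L f" using fA(1) fB(1) by (auto simp: list_colouring_def f_def)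
  ultimately show ?thesis by blast
qed

text \<open>The edge bound passes to induced subgraphs, so \<open>V - A\<close> can be coloured by
  induction. Graphs with fewer than \<open>n0\<close> vertices, about which the bound says nothing,
  are coloured equitably; this is where \<open>t\<close> enters.\<close>

lemma clustered_choosable_if_sparse:
  fixes L :: "'a \<Rightarrow> 'c set"
  assumes "simple_graph V E" and "list_assignment k V L" and "1 \<le> k" and "n0 \<le> k * t + 1"
    and "\<And>W. W \<subseteq> V \<Longrightarrow> n0 \<le> card W \<Longrightarrow> 4 * card (edges_in E W) < 3 * k * card W"
  shows "\<exists>f. list_colouring V L f \<and> clustered V E f (max t (57 * k - 51))"
  using assms
proof (induction "card V" arbitrary: V E rule: less_induct)
  case less
  interpret finite_simple_graph V E by (rule finite_simple_graph.intro) (rule less.prems)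
  show ?case
  proof (cases "card V < n0")
    case True
    then have "card V \<le> k * t" using less.prems(4) by linarith
    then obtain f where f: "list_colouring V L f" "\<And>c. card {v \<in> V. f v = c} \<le> t"
      using equitable_list_colouring[OF finite_V _ less.prems(2)] by blast
    have "clustered V E f (max t (57 * k - 51))" unfolding clustered_def
    proof
      fix v assume "v \<in> V"
      moreover have "card {u \<in> V. f u = f v} \<le> max t (57 * k - 51)" using f(2)[of "f v"] by simp
      moreover have "b \<in> V" if "{a, b} \<in> E" for a b using that simple by (auto simp: simple_graph_def)
      ultimately show "\<exists>K. v \<in> K \<and> K \<subseteq> V \<and> card K \<le> max t (57 * k - 51) \<and>
          (\<forall>a\<in>K. \<forall>b. {a, b} \<in> E \<and> f a = f b \<longrightarrow> b \<in> K)"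
        by (intro exI[of _ "{u \<in> V. f u = f v}"]) auto
    qed
    then show ?thesis using f(1) by blast
  next
    case False
    have "edges_in E V = E" using simple by (auto simp: edges_in_def simple_graph_def)
    then have "4 * card E < 3 * k * card V" using less.prems(5)[of V] False by simp
    then obtain A where A: "A \<noteq> {}" "A \<subseteq> V" and A_sparse:
      "\<And>S. S \<subseteq> A \<Longrightarrow> S \<noteq> {} \<Longrightarrow> 2 * card (edges_in E S) + (\<Sum>v\<in>S. card (nb (edges_in E A) v)) +
        3 * (\<Sum>v\<in>S. card (nb E v \<inter> (V - A))) < 3 * (k * card S)"
      using sparse_part by blast
    define B where "B = V - A"
    have BV: "B \<subseteq> V" by (auto simp: B_def)
    have "\<exists>f. list_colouring B L f \<and> clustered B (edges_in E B) f (max t (57 * k - 51))"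
    proof (rule less.hyps)
      show "card B < card V" unfolding B_def using A finite_V by (intro psubset_card_mono) auto
      show "simple_graph B (edges_in E B)" by (rule edges_in_simple[OF BV])
      show "list_assignment k B L" using less.prems(2) BV by (auto simp: list_assignment_def)
      fix W assume W: "W \<subseteq> B" "n0 \<le> card W"
      then have "edges_in (edges_in E B) W = edges_in E W" by (auto simp: edges_in_def)
      then show "4 * card (edges_in (edges_in E B) W) < 3 * k * card W"
        using less.prems(5)[of W] W BV by simp
    qed (use less.prems in auto)
    then obtain fB where fB: "list_colouring B L fB" "clustered B (edges_in E B) fB (max t (57 * k - 51))"
      by blast
    define dB where "dB = (\<lambda>v. card (nb E v \<inter> B))"
    \<comment> \<open>The condition for a single vertex gives \<open>3 * dB v < 3 * k\<close>, so
      the truncated subtraction \<open>k - dB v\<close> below is a true difference.\<close>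
    have dB: "dB v < k" if "v \<in> A" for v
      using A_sparse[of "{v}"] that by (simp add: dB_def B_def)
    \<comment> \<open>The lists are cut to exactly \<open>k - dB v\<close> colours. This makes
      infinite lists finite and lets the edges to \<open>B\<close> account exactly for the lost
      colours in the sparsity condition.\<close>
    have "\<exists>Y. Y \<subseteq> L v - fB ` (nb E v \<inter> B) \<and> card Y = k - dB v" if v: "v \<in> A" for v
    proof -
      have fin: "finite (fB ` (nb E v \<inter> B))" using finite_nb by simp
      have le: "card (fB ` (nb E v \<inter> B)) \<le> dB v"
        unfolding dB_def using finite_nb by (intro card_image_le) simp
      have "infinite (L v) \<or> k \<le> card (L v)" using less.prems(2) v A by (auto simp: list_assignment_def)
      then have "infinite (L v - fB ` (nb E v \<inter> B)) \<or> k - dB v \<le> card (L v - fB ` (nb E v \<inter> B))"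
        using diff_card_le_card_Diff[OF fin, of "L v"] le fin by (auto simp: Diff_infinite_finite)
      then show ?thesis by (rule subset_of_card) blast
    qed
    then obtain LA where LA: "\<And>v. v \<in> A \<Longrightarrow> LA v \<subseteq> L v - fB ` (nb E v \<inter> B) \<and> card (LA v) = k - dB v"
      by metis
    interpret A: sparse_list_graph A "edges_in E A" LA
    proof
      show "simple_graph A (edges_in E A)" by (rule edges_in_simple[OF A(2)])
      fix S assume S: "S \<subseteq> A" "S \<noteq> {}"
      have "(\<Sum>v\<in>S. card (LA v)) + (\<Sum>v\<in>S. dB v) = (\<Sum>v\<in>S. k)"
        unfolding sum.distrib[symmetric] using LA dB S by (intro sum.cong) (auto simp: less_imp_le)
      then have "(\<Sum>v\<in>S. card (LA v)) + (\<Sum>v\<in>S. dB v) = k * card S" by simp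
      moreover have "{e \<in> edges_in E A. e \<subseteq> S} = edges_in E S" using S by (auto simp: edges_in_def)
      ultimately show "2 * card {e \<in> edges_in E A. e \<subseteq> S} + (\<Sum>v\<in>S. card (nb (edges_in E A) v)) <
          3 * (\<Sum>v\<in>S. card (LA v))"
        using A_sparse[OF S] by (simp add: dB_def B_def)
    qed
    have "\<exists>f. list_colouring A LA f \<and> clustered A (edges_in E A) f (57 * k - 51)"
      by (rule A.clustered_list_colouring_exists) (use LA less.prems(3) in auto)
    then obtain fA where fA: "list_colouring A LA fA" "clustered A (edges_in E A) fA (max t (57 * k - 51))"
      using clustered_mono[of A _ _ "57 * k - 51"] by (meson max.cobounded2)
    have "list_colouring A L fA" using fA(1) LA by (auto simp: list_colouring_def)
    moreover have "fA a \<noteq> fB b" if "a \<in> A" "b \<in> B" "{a, b} \<in> E" for a b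
    proof -
      have "b \<in> nb E a \<inter> B" using that by (auto simp: nb_def insert_commute)
      moreover have "fA a \<in> L a - fB ` (nb E a \<inter> B)" using that fA(1) LA by (auto simp: list_colouring_def)
      ultimately show ?thesis by auto
    qed
    ultimately show ?thesis
      using clustered_list_colouring_by_extension[OF simple A(2) _ fA(2)] fB unfolding B_def by blast
  qed
qed

section \<open>Translation to monochromatic components and to the maximum average degree\<close>

lemma has_clustering_if_clustered:
  assumes "finite V" "clustered V E f c" shows "has_clustering V E f c"
  unfolding has_clustering_def
proof
  fix C assume "C \<in> monochromatic_components V E f"
  then obtain v where v: "v \<in> V"
    and C: "C \<subseteq> {u. (v, u) \<in> {(x, y). {x, y} \<in> monochromatic_edges E f}\<^sup>*}"
    by (auto simp: monochromatic_components_def connected_components_def quotient_def)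
  obtain K where K: "v \<in> K" "K \<subseteq> V" "card K \<le> c"
    "\<And>a b. a \<in> K \<Longrightarrow> {a, b} \<in> E \<Longrightarrow> f a = f b \<Longrightarrow> b \<in> K"
    using clusteredE[OF assms(2) v] by blast
  \<comment> \<open>A monochromatic walk from \<open>v\<close> never leaves the closed set
    \<open>K\<close>, so \<open>K\<close> contains the component.\<close>
  have "u \<in> K" if "(v, u) \<in> {(x, y). {x, y} \<in> monochromatic_edges E f}\<^sup>*" for u
    using that
  proof induction
    case (step y z)
    from step.hyps(2) have "{y, z} \<in> monochromatic_edges E f" by simp
    then have "{y, z} \<in> E" "f y = f z" unfolding monochromatic_edges_def by blast+
    then show ?case by (rule K(4)[OF step.IH])
  qed (rule K(1))
  then have "C \<subseteq> K" using C by blast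
  then have "card C \<le> card K" using K(2) assms(1) by (meson card_mono finite_subset)
  then show "card C \<le> c" using K(3) by simp
qed

lemma average_degree_eq:
  assumes "simple_graph W F" shows "average_degree W F = 2 * real (card F) / real (card W)"
proof -
  interpret finite_simple_graph W F using assms by (rule finite_simple_graph.intro)
  have "(\<Sum>v\<in>W. degree F v) = (\<Sum>e\<in>F. card (e \<inter> W))"
    using double_count[OF finite_V finite_E] by (simp add: degree_def)
  also have "\<dots> = (\<Sum>e\<in>F. 2)"
    using assms by (intro sum.cong) (auto simp: simple_graph_def Int_absorb2)
  finally have "(\<Sum>v\<in>W. real (degree F v)) = 2 * real (card F)"
    by (simp flip: of_nat_sum)
  then show ?thesis by (simp add: average_degree_def)
qed

text \<open>There are finitely many subgraphs, so \<open>Max\<close> is a true bound;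
  \<open>n0 \<le> card W \<le> card V\<close> excludes the default value 0 of
  \<open>mad\<close>.\<close>

lemma average_degree_le_mad:
  assumes "simple_graph V E" and W: "is_subgraph W F V E" "n0 \<le> card W"
  shows "average_degree W F \<le> mad V E n0"
proof -
  interpret finite_simple_graph V E using assms(1) by (rule finite_simple_graph.intro)
  have "{average_degree W F | W F. is_subgraph W F V E \<and> n0 \<le> card W} \<subseteq>
      (\<lambda>(W, F). average_degree W F) ` (Pow V \<times> Pow E)"
    by (auto simp: is_subgraph_def)
  then have "finite {average_degree W F | W F. is_subgraph W F V E \<and> n0 \<le> card W}"
    by (rule finite_subset) (use finite_V finite_E in auto)
  then have "average_degree W F \<le> Max {average_degree W F | W F. is_subgraph W F V E \<and> n0 \<le> card W}"
    using W by (intro Max_ge) auto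
  moreover have "card W \<le> card V" using W finite_V by (auto simp: is_subgraph_def intro: card_mono)
  ultimately show ?thesis using W(2) by (simp add: mad_def)
qed

theorem theorem8:
  fixes d n0 k :: nat and V :: "'a set" and E :: "'a set set"
  assumes "d \<ge> 0" and "n0 \<ge> 1" and "k \<ge> 1"
    and "simple_graph V E"
    and "mad V E n0 < 3 / 2 * real k"
  shows "choosable_with_clustering TYPE('c) V E k
           (max (nat \<lceil>(real n0 - 1) / real k\<rceil>) (57 * k - 51))"
  unfolding choosable_with_clustering_def
proof (intro allI impI)
  fix L :: "'a \<Rightarrow> 'c set"
  assume L: "list_assignment k V L"
  interpret finite_simple_graph V E using assms(4) by (rule finite_simple_graph.intro)
  define t where "t = nat \<lceil>(real n0 - 1) / real k\<rceil>"
  \<comment> \<open>Rounding up gives \<open>n0 - 1 \<le> k * t\<close>, the capacity needed to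
    colour fewer than \<open>n0\<close> vertices equitably.\<close>
  have "(real n0 - 1) / real k \<le> real t" unfolding t_def by linarith
  then have "real n0 - 1 \<le> real (k * t)" using assms(3) by (simp add: field_simps)
  then have "n0 \<le> k * t + 1" by linarith
  moreover have "4 * card (edges_in E W) < 3 * k * card W" if W: "W \<subseteq> V" "n0 \<le> card W" for W
  proof -
    have g: "simple_graph W (edges_in E W)" using W(1) by (rule edges_in_simple)
    then have "average_degree W (edges_in E W) \<le> mad V E n0"
      using W by (intro average_degree_le_mad[OF assms(4)]) (auto simp: is_subgraph_def edges_in_def)
    then have "2 * real (card (edges_in E W)) / real (card W) < 3 / 2 * real k"
      using assms(5) by (simp add: average_degree_eq[OF g])
    \<comment> \<open>\<open>n0 \<ge> 1\<close> makes \<open>W\<close> nonempty, so the denominator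
      may be cleared.\<close>
    then have "4 * real (card (edges_in E W)) < 3 * real k * real (card W)"
      using W(2) assms(2) by (simp add: field_simps)
    then have "real (4 * card (edges_in E W)) < real (3 * k * card W)" by simp
    then show ?thesis by (simp only: of_nat_less_iff)
  qed
  ultimately have "\<exists>f. list_colouring V L f \<and> clustered V E f (max t (57 * k - 51))"
    using clustered_choosable_if_sparse[OF assms(4) L assms(3)] by blast
  then show "\<exists>f. list_colouring V L f \<and>
      has_clustering V E f (max (nat \<lceil>(real n0 - 1) / real k\<rceil>) (57 * k - 51))"
    using has_clustering_if_clustered[OF finite_V] unfolding t_def by blast
qed

end
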